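(* Let $G=\mathrm{SL}(2,\mathbb{C})$ act on $G\times G$ by simultaneous conjugation. Then $$\mathbb{C}[G\times G]^G\cong\mathbb{C}[t_x,t_y,t_z],$$ the complex polynomial ring in three indeterminates. In particular, every regular function $f:\mathrm{SL}(2,\mathbb{C})\times \mathrm{SL}(2,\mathbb{C})\to\mathbb{C}$ satisfying $$f(\mathbf{x}_1,\mathbf{x}_2)=f(g\mathbf{x}_1g^{-1},g\mathbf{x}_2g^{-1})\qquad\text{for all }g\in \mathrm{SL}(2,\mathbb{C})$$ (and all $\mathbf{x}_1,\mathbf{x}_2$) can be written uniquely as a polynomial in the three trace variables $x=\mathrm{tr}(\mathbf{x}_1)$, $y=\mathrm{tr}(\mathbf{x}_2)$, $z=\mathrm{tr}(\mathbf{x}_1\mathbf{x}_2^{-1})$.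
   Context: $\mathbb{C}[G\times G]$ is the coordinate ring of the affine variety $G\times G$, i.e. the quotient of the polynomial ring in the $8$ matrix entries of $\mathbf{x}_1,\mathbf{x}_2$ by the ideal $(\det\mathbf{x}_1-1,\det\mathbf{x}_2-1)$; $\mathbb{C}[G\times G]^G$ is the subring of elements invariant under the action induced by $g\cdot(\mathbf{x}_1,\mathbf{x}_2)=(g\mathbf{x}_1g^{-1},g\mathbf{x}_2g^{-1})$. *)

theory Defs
  imports
    "HOL-Analysis.Analysis"
    "HOL-Library.Poly_Mapping"
    "HOL-Algebra.Algebraic_Closure_Type"
begin

text \<open>Complex polynomials with indeterminates indexed by the type \<open>'v\<close>: finitely supported
  coefficient functions on monomials, a monomial being a finitely supported exponent function.\<close>

type_synonym 'v cpoly = "('v \<Rightarrow>\<^sub>0 nat) \<Rightarrow>\<^sub>0 complex"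

definition Const :: "complex \<Rightarrow> 'v cpoly" where
  "Const c = Poly_Mapping.single 0 c"

definition Var :: "'v \<Rightarrow> 'v cpoly" where
  "Var v = Poly_Mapping.single (Poly_Mapping.single v 1) 1"

text \<open>The value of a polynomial under \<open>v \<mapsto> s v\<close> in a commutative ring, whose structure
  as a complex algebra is given by \<open>h\<close>.\<close>

definition eval_cpoly :: "(complex \<Rightarrow> 'b::comm_ring_1) \<Rightarrow> ('v \<Rightarrow> 'b) \<Rightarrow> 'v cpoly \<Rightarrow> 'b" where
  "eval_cpoly h s p =
     (\<Sum>m\<in>Poly_Mapping.keys p. h (Poly_Mapping.lookup p m) * (\<Prod>v\<in>Poly_Mapping.keys m. s v ^ Poly_Mapping.lookup m v))"

abbreviation cpoly_ring :: "'v cpoly ring" where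
  "cpoly_ring \<equiv> ring_of_type_algebra"

type_synonym cmat2 = "complex ^ 2 ^ 2"

definition SL2 :: "cmat2 set" where
  "SL2 = {A. det A = 1}"

text \<open>The index \<open>(k, i, j)\<close> stands for the entry \<open>(i, j)\<close> of the matrix \<open>\<bold>x\<^sub>k\<close>.
  The numeral type \<open>2\<close> has exactly the two elements \<open>1\<close> and \<open>2\<close>.\<close>

type_synonym entry = "2 \<times> 2 \<times> 2"

definition gen_mat :: "2 \<Rightarrow> entry cpoly ^ 2 ^ 2" where
  "gen_mat k = (\<chi> i j. Var (k, i, j))"

fun entry_of :: "cmat2 \<times> cmat2 \<Rightarrow> entry \<Rightarrow> complex" where
  "entry_of (x\<^sub>1, x\<^sub>2) (k, i, j) = (if k = 1 then x\<^sub>1 else x\<^sub>2) $ i $ j"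

definition det_ideal :: "entry cpoly set" where
  "det_ideal = Idl\<^bsub>cpoly_ring\<^esub> {det (gen_mat 1) - 1, det (gen_mat 2) - 1}"

definition coord_ring :: "entry cpoly set ring" where
  "coord_ring = cpoly_ring Quot det_ideal"

definition residue_class :: "entry cpoly \<Rightarrow> entry cpoly set" where
  "residue_class p = det_ideal +>\<^bsub>cpoly_ring\<^esub> p"

text \<open>The comorphism of \<open>(\<bold>x\<^sub>1, \<bold>x\<^sub>2) \<mapsto> (g \<bold>x\<^sub>1 g\<^sup>-\<^sup>1, g \<bold>x\<^sub>2 g\<^sup>-\<^sup>1)\<close>, first on
  polynomials and then on residue classes. As a left action \<open>g\<close> acts by the comorphism of
  \<open>g\<^sup>-\<^sup>1\<close>; the invariants are the same.\<close>

definition conj_subst :: "cmat2 \<Rightarrow> entry cpoly \<Rightarrow> entry cpoly" where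
  "conj_subst g = eval_cpoly Const
     (\<lambda>(k, i, j). ((\<chi> i j. Const (g $ i $ j)) ** gen_mat k **
                   (\<chi> i j. Const (matrix_inv g $ i $ j))) $ i $ j)"

text \<open>Conjugation by \<open>g \<in> SL2\<close> maps the ideal into itself, so all members of the following
  union are the same residue class.\<close>

definition conj_class :: "cmat2 \<Rightarrow> entry cpoly set \<Rightarrow> entry cpoly set" where
  "conj_class g c = (\<Union>p\<in>c. residue_class (conj_subst g p))"

definition invariant_ring :: "entry cpoly set ring" where
  "invariant_ring = coord_ring
     \<lparr>carrier := {c \<in> carrier coord_ring. \<forall>g\<in>SL2. conj_class g c = c}\<rparr>"

text \<open>Isomorphism of complex algebras, each algebra being a ring together with its structure map
  from the complex numbers.\<close>

definition calg_isomorphic ::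
    "'a ring \<Rightarrow> (complex \<Rightarrow> 'a) \<Rightarrow> 'b ring \<Rightarrow> (complex \<Rightarrow> 'b) \<Rightarrow> bool" where
  "calg_isomorphic A \<iota> B \<kappa> \<longleftrightarrow> (\<exists>\<phi>\<in>ring_iso A B. \<forall>c. \<phi> (\<iota> c) = \<kappa> c)"

text \<open>Only the values on \<open>SL2 \<times> SL2\<close> matter.\<close>

definition regular_on_SL2_SL2 :: "(cmat2 \<times> cmat2 \<Rightarrow> complex) \<Rightarrow> bool" where
  "regular_on_SL2_SL2 f \<longleftrightarrow>
     (\<exists>p :: entry cpoly. \<forall>x\<in>SL2 \<times> SL2. f x = eval_cpoly (\<lambda>c. c) (entry_of x) p)"

datatype tvar = t_x | t_y | t_z

fun trace_coords :: "cmat2 \<times> cmat2 \<Rightarrow> tvar \<Rightarrow> complex" where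
  "trace_coords (x\<^sub>1, x\<^sub>2) t_x = trace x\<^sub>1"
| "trace_coords (x\<^sub>1, x\<^sub>2) t_y = trace x\<^sub>2"
| "trace_coords (x\<^sub>1, x\<^sub>2) t_z = trace (x\<^sub>1 ** matrix_inv x\<^sub>2)"

end

theory Submission
  imports Defs
begin

text \<open>
  The trace map sends a pair \<open>(A, B)\<close> of matrices of determinant \<open>1\<close> to \<open>(x, y, z)\<close> with \<open>x = tr A\<close>,
  \<open>y = tr B\<close>, \<open>z = tr (A B\<^sup>-\<^sup>1)\<close>. Substituting the traces into polynomials in three indeterminates
  gives a homomorphism into the invariant ring, and the content of the theorem is that it is
  bijective. Everything rests on an explicit section of the trace map, up to the choice of \<open>\<zeta>\<close> with
  \<open>\<zeta> + 1 / \<zeta> = z\<close>: the pair consisting of the matrices with rows \<open>(x, -1)\<close>, \<open>(1, 0)\<close> and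
  \<open>(y, -\<zeta>)\<close>, \<open>(1 / \<zeta>, 0)\<close>.

  Injectivity holds because the section makes the trace map surjective (\<open>trace_coords_surj\<close>), and a
  complex polynomial that vanishes at all points is zero (\<open>cpoly_eq_0_if_vanishing\<close>).

  For surjectivity, restrict an invariant function to the section. This yields a polynomial in \<open>x\<close>,
  \<open>y\<close>, \<open>\<zeta>\<close>, \<open>1 / \<zeta>\<close>, that is \<open>Q + \<zeta> R\<close> with \<open>Q\<close>, \<open>R\<close> polynomials in \<open>x\<close>, \<open>y\<close>, \<open>z\<close>
  (\<open>value_on_section\<close>). A pair whose commutator \<open>A B - B A\<close> is invertible has no common eigenvector
  and is conjugate to the section pair over its traces for either choice of \<open>\<zeta>\<close>
  (\<open>conjugate_to_section\<close>). Averaging over \<open>\<zeta>\<close> and \<open>1 / \<zeta>\<close> shows that the function agrees with the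
  polynomial \<open>Q + z R / 2\<close> in the traces on all these pairs. The agreement extends to all pairs,
  because any two pairs are joined by a polynomial curve
  (\<open>zero_on_SL2_pairs_if_generically_zero\<close>); the outcome is \<open>invariant_polynomial_in_traces\<close>.

  These arguments concern functions on pairs, while the coordinate ring is a quotient of a polynomial
  ring. The bridge is \<open>vanishing_imp_det_ideal\<close>: a polynomial that vanishes on all pairs lies in the
  ideal generated by the two determinant relations. Written in terms of the trace, each relation is a
  monic quadratic equation for the upper left entry, which provides a normal form of degree at most
  one in each of these two entries; its coefficients are recovered from the values at the different
  roots.
\<close>

section \<open>Evaluation and substitution\<close>

text \<open>Both evaluation at points and substitution of polynomials are instances of \<open>eval_cpoly\<close>;
  they share the ring homomorphism laws once the structure map of the target is a ring
  homomorphism.\<close>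

locale scalar_hom =
  fixes h :: "complex \<Rightarrow> 'b::comm_ring_1"
  assumes h_zero: "h 0 = 0" and h_one: "h 1 = 1"
    and h_add: "h (c + d) = h c + h d" and h_mult: "h (c * d) = h c * h d"

lemma scalar_hom_id: "scalar_hom (\<lambda>c. c)"
  by unfold_locales auto

lemma scalar_hom_Const: "scalar_hom (Const :: complex \<Rightarrow> 'v cpoly)"
  by unfold_locales (simp_all add: Const_def single_add mult_single)

definition monom_value :: "('v \<Rightarrow> 'b::comm_ring_1) \<Rightarrow> ('v \<Rightarrow>\<^sub>0 nat) \<Rightarrow> 'b" where
  "monom_value s m = (\<Prod>v\<in>Poly_Mapping.keys m. s v ^ Poly_Mapping.lookup m v)"

lemma monom_value_superset:
  assumes "finite K" "Poly_Mapping.keys m \<subseteq> K"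
  shows "monom_value s m = (\<Prod>v\<in>K. s v ^ Poly_Mapping.lookup m v)"
  unfolding monom_value_def
  by (rule prod.mono_neutral_left) (use assms in \<open>auto simp: in_keys_iff\<close>)

lemma monom_value_zero [simp]: "monom_value s 0 = 1"
  by (simp add: monom_value_def)

lemma monom_value_add: "monom_value s (m + n) = monom_value s m * monom_value s n"
proof -
  let ?K = "Poly_Mapping.keys m \<union> Poly_Mapping.keys n"
  have "Poly_Mapping.keys (m + n) \<subseteq> ?K"
    by (rule Poly_Mapping.keys_add)
  then show ?thesis
    by (simp add: monom_value_superset[of ?K] lookup_add power_add prod.distrib)
qed

lemma monom_value_single [simp]: "monom_value s (Poly_Mapping.single v n) = s v ^ n"
  by (simp add: monom_value_superset[of "{v}"])

lemma eval_cpoly_superset: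
  assumes "h 0 = 0" "finite K" "Poly_Mapping.keys p \<subseteq> K"
  shows "eval_cpoly h s p = (\<Sum>m\<in>K. h (Poly_Mapping.lookup p m) * monom_value s m)"
  unfolding eval_cpoly_def monom_value_def[symmetric]
  by (rule sum.mono_neutral_left) (use assms in \<open>auto simp: in_keys_iff\<close>)

lemma update_eq_add_single:
  assumes "k \<notin> Poly_Mapping.keys (f :: 'a \<Rightarrow>\<^sub>0 'b::comm_monoid_add)"
  shows "Poly_Mapping.update k b f = f + Poly_Mapping.single k b"
  using assms by (intro poly_mapping_eqI) (auto simp: lookup_update lookup_add lookup_single in_keys_iff)

lemma poly_mapping_sum_induct [case_names single add]:
  fixes f :: "'a \<Rightarrow>\<^sub>0 'b::comm_monoid_add"
  assumes "\<And>k b. P (Poly_Mapping.single k b)" and "\<And>f g. P f \<Longrightarrow> P g \<Longrightarrow> P (f + g)"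
  shows "P f"
proof (induction f rule: update_induct)
  case const
  show ?case using assms(1)[of _ 0] by simp
next
  case (update f k b)
  then show ?case by (simp add: update_eq_add_single assms)
qed

lemma Var_power: "Var v ^ n = Poly_Mapping.single (Poly_Mapping.single v n) 1"
proof (induction n)
  case 0
  then show ?case by simp
next
  case (Suc n)
  then show ?case by (simp add: Var_def mult_single single_add[symmetric])
qed

text \<open>Constants and variables generate the polynomial ring, so every property that is stable under
  sums and products only has to be tested on them. All later constructions of polynomials out of
  polynomials (normal forms, restriction to curves, restriction to the section) are inductions of
  this kind.\<close>

lemma cpoly_induct [case_names Const Var add mult]:
  fixes p :: "'v cpoly"
  assumes C: "\<And>c. P (Const c)" and V: "\<And>v. P (Var v)"
    and A: "\<And>p q. P p \<Longrightarrow> P q \<Longrightarrow> P (p + q)" and M: "\<And>p q. P p \<Longrightarrow> P q \<Longrightarrow> P (p * q)"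
  shows "P p"
proof (induction p rule: poly_mapping_sum_induct)
  case (single m c)
  have "P (Poly_Mapping.single m (1::complex))"
  proof (induction m rule: poly_mapping_sum_induct)
    case (single v n)
    have "P (Var v ^ n)"
    proof (induction n)
      case 0
      then show ?case using C[of 1] by (simp add: Const_def)
    next
      case (Suc n)
      then show ?case using M[OF V] by simp
    qed
    then show ?case by (simp add: Var_power)
  next
    case (add m n)
    then show ?case using M by (fastforce simp: mult_single)
  qed
  then have "P (Const c * Poly_Mapping.single m 1)"
    using C M by blast
  then show ?case by (simp add: Const_def mult_single)
next
  case (add p q)
  then show ?case by (rule A)
qed

context scalar_hom
begin

lemma h_uminus: "h (- c) = - h c"
proof -
  have "h (c + - c) = h c + h (- c)" by (rule h_add)
  then show ?thesis by (simp add: h_zero eq_neg_iff_add_eq_0 add.commute)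
qed

lemma eval_single: "eval_cpoly h s (Poly_Mapping.single m c) = h c * monom_value s m"
  by (simp add: eval_cpoly_superset[of h "{m}"] h_zero)

lemma eval_Const [simp]: "eval_cpoly h s (Const c) = h c"
  by (simp add: Const_def eval_single)

lemma eval_Var [simp]: "eval_cpoly h s (Var v) = s v"
  by (simp add: Var_def eval_single h_one)

lemma eval_zero [simp]: "eval_cpoly h s 0 = 0"
  by (simp add: eval_cpoly_def)

lemma eval_one [simp]: "eval_cpoly h s 1 = 1"
  using eval_Const[of s 1] by (simp add: Const_def h_one)

lemma eval_add [simp]: "eval_cpoly h s (p + q) = eval_cpoly h s p + eval_cpoly h s q"
proof -
  let ?K = "Poly_Mapping.keys p \<union> Poly_Mapping.keys q"
  have "Poly_Mapping.keys (p + q) \<subseteq> ?K"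
    by (rule Poly_Mapping.keys_add)
  then show ?thesis
    by (simp add: eval_cpoly_superset[of h ?K] h_zero lookup_add h_add distrib_right sum.distrib)
qed

lemma eval_mult [simp]: "eval_cpoly h s (p * q) = eval_cpoly h s p * eval_cpoly h s q"
proof (induction p rule: poly_mapping_sum_induct)
  case (single m c)
  show ?case
    by (induction q rule: poly_mapping_sum_induct)
      (simp_all add: mult_single eval_single h_mult monom_value_add distrib_left mult.assoc mult.left_commute)
next
  case (add f g)
  then show ?case by (simp add: distrib_right)
qed

lemma eval_uminus [simp]: "eval_cpoly h s (- p) = - eval_cpoly h s p"
proof -
  have "eval_cpoly h s (p + - p) = eval_cpoly h s p + eval_cpoly h s (- p)"
    by (rule eval_add)
  then show ?thesis by (simp add: eq_neg_iff_add_eq_0 add.commute)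
qed

lemma eval_diff [simp]: "eval_cpoly h s (p - q) = eval_cpoly h s p - eval_cpoly h s q"
  using eval_add[of s p "- q"] by simp

end

abbreviation value_at :: "('v \<Rightarrow> complex) \<Rightarrow> 'v cpoly \<Rightarrow> complex" where
  "value_at \<equiv> eval_cpoly (\<lambda>c. c)"

abbreviation subst_cpoly :: "('v \<Rightarrow> 'w cpoly) \<Rightarrow> 'v cpoly \<Rightarrow> 'w cpoly" where
  "subst_cpoly \<equiv> eval_cpoly Const"

interpretation value_at: scalar_hom "\<lambda>c::complex. c"
  by (rule scalar_hom_id)

interpretation subst: scalar_hom "Const :: complex \<Rightarrow> 'v cpoly"
  by (rule scalar_hom_Const)

lemma value_at_subst: "value_at s (subst_cpoly \<sigma> p) = value_at (\<lambda>v. value_at s (\<sigma> v)) p"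
  by (induction p rule: cpoly_induct) simp_all

section \<open>Polynomials determined by their values\<close>

text \<open>Dedekind's argument for the independence of characters: evaluation of a monomial is
  multiplicative in the point. Rescaling the points by \<open>u\<close> and subtracting \<open>monom_value u n\<close> times
  the original relation removes the monomial \<open>n\<close>, and multiplies the coefficient of \<open>m\<close> by
  \<open>monom_value u m - monom_value u n\<close>.\<close>

lemma monom_values_independent:
  fixes c :: "('v \<Rightarrow>\<^sub>0 nat) \<Rightarrow> complex"
  assumes "finite K" and "\<And>s. (\<Sum>m\<in>K. c m * monom_value s m) = 0" and "m \<in> K"
  shows "c m = 0"
  using assms
proof (induction K arbitrary: c m rule: finite_induct)
  case empty
  then show ?case by simp
next
  case (insert n K)
  have rest: "c m = 0" if "m \<in> K" for m
  proof -
    have "m \<noteq> n" using that insert.hyps by blast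
    then obtain v where v: "Poly_Mapping.lookup m v \<noteq> Poly_Mapping.lookup n v"
      by (metis poly_mapping_eqI)
    \<comment> \<open>Rescaling one variable by \<open>2\<close> separates monomials with different exponents in it, because
        powers of \<open>2\<close> are distinct.\<close>
    define u :: "'v \<Rightarrow> complex" where "u = (\<lambda>w. if w = v then 2 else 1)"
    have u: "monom_value u k = 2 ^ Poly_Mapping.lookup k v" for k
    proof -
      have "monom_value u k = (\<Prod>w\<in>insert v (Poly_Mapping.keys k). u w ^ Poly_Mapping.lookup k w)"
        by (rule monom_value_superset) auto
      also have "\<dots> = (\<Prod>w\<in>insert v (Poly_Mapping.keys k). if w = v then 2 ^ Poly_Mapping.lookup k v else 1)"
        by (rule prod.cong) (auto simp: u_def)
      also have "\<dots> = 2 ^ Poly_Mapping.lookup k v"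
        by simp
      finally show ?thesis .
    qed
    have mult: "monom_value (\<lambda>w. u w * s w) k = monom_value u k * monom_value s k"
      for s and k :: "'v \<Rightarrow>\<^sub>0 nat"
      by (simp add: monom_value_def power_mult_distrib prod.distrib)
    have "(\<Sum>k\<in>K. (c k * (monom_value u k - monom_value u n)) * monom_value s k) = 0" for s
    proof -
      have "0 = (\<Sum>k\<in>insert n K. c k * monom_value (\<lambda>w. u w * s w) k)
                 - monom_value u n * (\<Sum>k\<in>insert n K. c k * monom_value s k)"
        unfolding insert.prems(1) by simp
      also have "\<dots> = (\<Sum>k\<in>insert n K. (c k * (monom_value u k - monom_value u n)) * monom_value s k)"
        unfolding sum_distrib_left sum_subtractf[symmetric]
        by (rule sum.cong, rule refl) (simp only: mult, simp add: algebra_simps)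
      also have "\<dots> = (\<Sum>k\<in>K. (c k * (monom_value u k - monom_value u n)) * monom_value s k)"
        using insert.hyps by simp
      finally show ?thesis by simp
    qed
    from insert.IH[of "\<lambda>k. c k * (monom_value u k - monom_value u n)", OF this that]
    have "c m * (monom_value u m - monom_value u n) = 0" .
    moreover have "monom_value u m \<noteq> monom_value u n"
    proof
      assume "monom_value u m = monom_value u n"
      then have "complex_of_nat (2 ^ Poly_Mapping.lookup m v) = of_nat (2 ^ Poly_Mapping.lookup n v)"
        by (simp add: u)
      then show False
        using v unfolding of_nat_eq_iff by simp
    qed
    ultimately show ?thesis by simp
  qed
  moreover have "c n = 0"
  proof -
    have "(\<Sum>k\<in>K. c k * monom_value (\<lambda>_. 1) k) = 0"
      by (rule sum.neutral) (simp add: rest)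
    then have "c n * monom_value (\<lambda>_. 1) n = 0"
      using insert.prems(1)[of "\<lambda>_. 1"] insert.hyps by simp
    then show ?thesis by (simp add: monom_value_def)
  qed
  ultimately show ?case using insert.prems(2) by blast
qed

lemma cpoly_eq_0_if_vanishing:
  assumes "\<And>s. value_at s p = 0"
  shows "p = 0"
proof (rule poly_mapping_eqI)
  fix m
  have "Poly_Mapping.lookup p m = 0" if "m \<in> Poly_Mapping.keys p"
    using monom_values_independent[of "Poly_Mapping.keys p" "Poly_Mapping.lookup p" m] assms that
    by (simp add: eval_cpoly_def monom_value_def)
  then show "Poly_Mapping.lookup p m = Poly_Mapping.lookup 0 m"
    by (auto simp: in_keys_iff)
qed

lemma value_along_curve:
  fixes P :: "'v \<Rightarrow> complex poly"
  shows "\<exists>Q. \<forall>t. value_at (\<lambda>v. poly (P v) t) p = poly Q t"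
proof (induction p rule: cpoly_induct)
  case (Const c)
  have "\<forall>t. value_at (\<lambda>v. poly (P v) t) (Const c) = poly [:c:] t" by simp
  then show ?case ..
next
  case (Var v)
  have "\<forall>t. value_at (\<lambda>v. poly (P v) t) (Var v) = poly (P v) t" by simp
  then show ?case ..
next
  case (add p q)
  then obtain F G where "\<forall>t. value_at (\<lambda>v. poly (P v) t) p = poly F t"
    "\<forall>t. value_at (\<lambda>v. poly (P v) t) q = poly G t" by blast
  then have "\<forall>t. value_at (\<lambda>v. poly (P v) t) (p + q) = poly (F + G) t" by simp
  then show ?case ..
next
  case (mult p q)
  then obtain F G where "\<forall>t. value_at (\<lambda>v. poly (P v) t) p = poly F t"
    "\<forall>t. value_at (\<lambda>v. poly (P v) t) q = poly G t" by blast
  then have "\<forall>t. value_at (\<lambda>v. poly (P v) t) (p * q) = poly (F * G) t" by simp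
  then show ?case ..
qed

text \<open>Along a polynomial curve both \<open>p\<close> and \<open>h\<close> become polynomials in one parameter whose product
  is zero. This is how all density arguments below are carried out: on a set whose points are
  joined by polynomial curves, an identity that holds where \<open>h \<noteq> 0\<close> holds everywhere.\<close>

lemma zero_along_curve:
  fixes P :: "'v \<Rightarrow> complex poly"
  assumes zero: "\<And>t. value_at (\<lambda>v. poly (P v) t) h \<noteq> 0 \<Longrightarrow> value_at (\<lambda>v. poly (P v) t) p = 0"
    and "value_at (\<lambda>v. poly (P v) t0) h \<noteq> 0"
  shows "value_at (\<lambda>v. poly (P v) t) p = 0"
proof -
  obtain Q H where Q: "\<And>t. value_at (\<lambda>v. poly (P v) t) p = poly Q t"
    and H: "\<And>t. value_at (\<lambda>v. poly (P v) t) h = poly H t"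
    using value_along_curve by metis
  have "poly (Q * H) t = 0" for t
    using zero[of t] by (auto simp: Q H)
  then have "Q * H = 0"
    using poly_all_0_iff_0 by blast
  moreover have "H \<noteq> 0"
    using assms(2) by (auto simp: H)
  ultimately show ?thesis by (simp add: Q)
qed

lemma cpoly_eq_0_if_generically_vanishing:
  assumes zero: "\<And>s. value_at s h \<noteq> 0 \<Longrightarrow> value_at s p = 0" and "value_at s0 h \<noteq> 0"
  shows "p = 0"
proof (rule cpoly_eq_0_if_vanishing)
  fix s
  \<comment> \<open>The curve is the line from \<open>s\<close> to \<open>s0\<close>.\<close>
  have "value_at (\<lambda>v. poly [:s v, s0 v - s v:] 0) p = 0"
  proof (rule zero_along_curve)
    show "value_at (\<lambda>v. poly [:s v, s0 v - s v:] 1) h \<noteq> 0"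
      using assms(2) by simp
  qed (rule zero)
  then show "value_at s p = 0" by simp
qed

section \<open>The ideal of the determinant relations is the vanishing ideal\<close>

abbreviation det_rel :: "2 \<Rightarrow> entry cpoly" where
  "det_rel k \<equiv> det (gen_mat k) - 1"

lemma det_rel_eq: "det_rel k = Var (k, 1, 1) * Var (k, 2, 2) - Var (k, 1, 2) * Var (k, 2, 1) - 1"
  by (simp add: det_2 gen_mat_def)

lemma cpoly_ring_simps [simp]:
  "carrier (cpoly_ring :: 'v cpoly ring) = UNIV"
  "x \<otimes>\<^bsub>(cpoly_ring :: 'v cpoly ring)\<^esub> y = x * y"
  "x \<oplus>\<^bsub>(cpoly_ring :: 'v cpoly ring)\<^esub> y = x + y"
  "\<one>\<^bsub>(cpoly_ring :: 'v cpoly ring)\<^esub> = 1"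
  "\<zero>\<^bsub>(cpoly_ring :: 'v cpoly ring)\<^esub> = 0"
  by (simp_all add: ring_of_type_algebra_def)

lemma ring_cpoly_ring: "ring (cpoly_ring :: 'v cpoly ring)"
  by (rule ring_from_type_algebra)

lemma ideal_det_ideal: "ideal det_ideal cpoly_ring"
  unfolding det_ideal_def
  by (rule ring.genideal_ideal[OF ring_cpoly_ring]) simp

lemma a_inv_cpoly_ring [simp]: "\<ominus>\<^bsub>(cpoly_ring :: 'v cpoly ring)\<^esub> x = - x"
  by (rule abelian_group.minus_equality[OF ring.is_abelian_group[OF ring_cpoly_ring]]) simp_all

text \<open>The ideal lives in a ring with explicit carrier, the polynomials in a type class; this
  translates the closure properties into type class notation.\<close>

lemma det_ideal_closed:
  "0 \<in> det_ideal"
  "p \<in> det_ideal \<Longrightarrow> q \<in> det_ideal \<Longrightarrow> p + q \<in> det_ideal"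
  "p \<in> det_ideal \<Longrightarrow> r * p \<in> det_ideal"
  "det_rel k \<in> det_ideal"
proof -
  interpret ideal det_ideal "cpoly_ring :: entry cpoly ring"
    by (rule ideal_det_ideal)
  show "0 \<in> det_ideal"
    using additive_subgroup.zero_closed[OF additive_subgroup_axioms] by simp
  show "p \<in> det_ideal \<Longrightarrow> q \<in> det_ideal \<Longrightarrow> p + q \<in> det_ideal"
    using additive_subgroup.a_closed[OF additive_subgroup_axioms] by simp
  show "p \<in> det_ideal \<Longrightarrow> r * p \<in> det_ideal"
    using I_l_closed by simp
  have "{det_rel 1, det_rel 2} \<subseteq> det_ideal"
    unfolding det_ideal_def by (rule genideal_self) simp
  then show "det_rel k \<in> det_ideal"
    using exhaust_2[of k] by auto
qed

lemma det_ideal_vanishes: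
  assumes "p \<in> det_ideal" "x \<in> SL2 \<times> SL2"
  shows "value_at (entry_of x) p = 0"
proof -
  let ?J = "{p. value_at (entry_of x) p = 0}"
  have "ideal ?J cpoly_ring"
  proof (rule idealI[OF ring_cpoly_ring])
    show "subgroup ?J (add_monoid cpoly_ring)"
    proof (rule subgroup.intro)
      fix q :: "entry cpoly"
      assume "q \<in> ?J"
      then have "\<ominus>\<^bsub>cpoly_ring\<^esub> q \<in> ?J" by simp
      then show "inv\<^bsub>add_monoid cpoly_ring\<^esub> q \<in> ?J"
        unfolding a_inv_def .
    qed auto
  qed auto
  moreover have "{det_rel 1, det_rel 2} \<subseteq> ?J"
    using assms(2) by (cases x) (auto simp: gen_mat_def SL2_def det_2)
  ultimately have "det_ideal \<subseteq> ?J"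
    unfolding det_ideal_def by (rule ring.genideal_minimal[OF ring_cpoly_ring])
  then show ?thesis using assms(1) by blast
qed

definition sub_semiring :: "'a::comm_ring_1 set \<Rightarrow> bool" where
  "sub_semiring S \<longleftrightarrow> 0 \<in> S \<and> 1 \<in> S \<and> (\<forall>p\<in>S. \<forall>q\<in>S. p + q \<in> S \<and> p * q \<in> S)"

text \<open>The set \<open>S + S a\<close> modulo the determinant relations.\<close>

definition adjoin :: "entry cpoly set \<Rightarrow> entry cpoly \<Rightarrow> entry cpoly set" where
  "adjoin S a = {p. \<exists>u\<in>S. \<exists>v\<in>S. p - (u + v * a) \<in> det_ideal}"

lemma adjoinE:
  assumes "p \<in> adjoin S a"
  obtains u v where "u \<in> S" "v \<in> S" "p - (u + v * a) \<in> det_ideal"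
  using assms unfolding adjoin_def by blast

lemma adjoin_base:
  assumes "sub_semiring S" "p \<in> S"
  shows "p \<in> adjoin S a"
proof -
  have "p - (p + 0 * a) \<in> det_ideal"
    by (simp add: det_ideal_closed)
  then show ?thesis
    using assms unfolding adjoin_def sub_semiring_def by blast
qed

lemma adjoin_gen:
  assumes "sub_semiring S"
  shows "a \<in> adjoin S a"
proof -
  have "a - (0 + 1 * a) \<in> det_ideal"
    by (simp add: det_ideal_closed)
  then show ?thesis
    using assms unfolding adjoin_def sub_semiring_def by blast
qed

text \<open>A monic quadratic relation for \<open>a\<close> over \<open>S\<close> reduces every product of two elements of
  \<open>S + S a\<close> to one of the same shape.\<close>

lemma sub_semiring_adjoin:
  assumes S: "sub_semiring S" and "t \<in> S" "m \<in> S" and rel: "a * a - (t * a + m) \<in> det_ideal"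
  shows "sub_semiring (adjoin S a)"
  unfolding sub_semiring_def
proof (intro conjI ballI)
  have cl: "x + y \<in> S" "x * y \<in> S" if "x \<in> S" "y \<in> S" for x y
    using S that by (auto simp: sub_semiring_def)
  show "0 \<in> adjoin S a" "1 \<in> adjoin S a"
    using adjoin_base[OF S] S by (auto simp: sub_semiring_def)
  fix p q
  assume "p \<in> adjoin S a" "q \<in> adjoin S a"
  then obtain u v u' v' where uv: "u \<in> S" "v \<in> S" "u' \<in> S" "v' \<in> S"
    and p: "p - (u + v * a) \<in> det_ideal" and q: "q - (u' + v' * a) \<in> det_ideal"
    by (auto simp: adjoin_def)
  have "(p + q) - ((u + u') + (v + v') * a) = (p - (u + v * a)) + (q - (u' + v' * a))"
    by (simp add: algebra_simps)
  then have "(p + q) - ((u + u') + (v + v') * a) \<in> det_ideal"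
    using p q det_ideal_closed by metis
  then show "p + q \<in> adjoin S a"
    using uv cl unfolding adjoin_def by blast
  have "p * q - ((u * u' + v * v' * m) + (u * v' + v * u' + v * v' * t) * a)
      = q * (p - (u + v * a)) + (u + v * a) * (q - (u' + v' * a)) + (v * v') * (a * a - (t * a + m))"
    by (simp add: algebra_simps)
  then have "p * q - ((u * u' + v * v' * m) + (u * v' + v * u' + v * v' * t) * a) \<in> det_ideal"
    using p q rel det_ideal_closed by metis
  moreover have "u * u' + v * v' * m \<in> S" "u * v' + v * u' + v * v' * t \<in> S"
    using uv cl assms(2,3) by auto
  ultimately show "p * q \<in> adjoin S a"
    unfolding adjoin_def by blast
qed

text \<open>The relation \<open>a d - b c = 1\<close> is not monic in any of the matrix entries, but in terms of the
  trace \<open>t = a + d\<close> it reads \<open>a\<^sup>2 = t a - (b c + 1)\<close>. The range of this substitution is the ring of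
  polynomials in \<open>t\<close>, \<open>b\<close>, \<open>c\<close> of both matrices. The value \<open>0\<close> at the index \<open>(k, 2, 2)\<close> is a
  placeholder, which leaves three coordinates for each matrix.\<close>

fun trace_subst :: "entry \<Rightarrow> entry cpoly" where
  "trace_subst (k, i, j) =
     (if i \<noteq> j then Var (k, i, j) else if i = 1 then Var (k, 1, 1) + Var (k, 2, 2) else 0)"

lemma sub_semiring_range_subst: "sub_semiring (range (subst_cpoly \<sigma>))"
  unfolding sub_semiring_def
proof (intro conjI ballI)
  show "0 \<in> range (subst_cpoly \<sigma>)"
    by (rule range_eqI[where x = 0]) simp
  show "1 \<in> range (subst_cpoly \<sigma>)"
    by (rule range_eqI[where x = 1]) simp
  fix p q
  assume "p \<in> range (subst_cpoly \<sigma>)" "q \<in> range (subst_cpoly \<sigma>)"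
  then obtain p' q' where "p = subst_cpoly \<sigma> p'" "q = subst_cpoly \<sigma> q'"
    by blast
  then show "p + q \<in> range (subst_cpoly \<sigma>)" "p * q \<in> range (subst_cpoly \<sigma>)"
    by (auto intro: range_eqI[where x = "p' + q'"] range_eqI[where x = "p' * q'"])
qed

text \<open>Modulo the two determinant relations every polynomial has the form
  \<open>A + B a + C a' + D a a'\<close>, where \<open>a\<close> and \<open>a'\<close> are the upper left entries and \<open>A\<close>, \<open>B\<close>, \<open>C\<close>, \<open>D\<close>
  are polynomials in the traces and the off-diagonal entries: adjoin \<open>a\<close> and then \<open>a'\<close> to the ring
  of these polynomials.\<close>

lemma entry_cpoly_normal_form:
  "p \<in> adjoin (adjoin (range (subst_cpoly trace_subst)) (Var (1, 1, 1))) (Var (2, 1, 1))"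
proof -
  let ?S0 = "range (subst_cpoly trace_subst)"
  let ?a = "\<lambda>k :: 2. Var (k, 1, 1) :: entry cpoly"
  let ?t = "\<lambda>k :: 2. Var (k, 1, 1) + Var (k, 2, 2) :: entry cpoly"
  let ?m = "\<lambda>k :: 2. Const (- 1) * (Var (k, 1, 2) * Var (k, 2, 1) + 1) :: entry cpoly"
  let ?S1 = "adjoin ?S0 (?a 1)"
  let ?S2 = "adjoin ?S1 (?a 2)"
  have C0: "Const c \<in> ?S0" for c
    by (metis rangeI subst.eval_Const)
  have V0: "trace_subst v \<in> ?S0" for v
    by (metis rangeI subst.eval_Var)
  have S0: "sub_semiring ?S0"
    by (rule sub_semiring_range_subst)
  have t0: "?t k \<in> ?S0" for k
    using V0[of "(k, 1, 1)"] by simp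
  have off0: "Var (k, 1, 2) \<in> ?S0" "Var (k, 2, 1) \<in> ?S0" for k
    using V0[of "(k, 1, 2)"] V0[of "(k, 2, 1)"] by simp_all
  have m0: "?m k \<in> ?S0" for k
    using S0 C0[of "- 1"] off0[of k] unfolding sub_semiring_def by blast
  have minus1: "Const (- 1) = (- 1 :: entry cpoly)"
    using subst.h_uminus[of 1] by (simp add: subst.h_one)
  have rel: "?a k * ?a k - (?t k * ?a k + ?m k) \<in> det_ideal" for k
  proof -
    have "?a k * ?a k - (?t k * ?a k + ?m k) = (- 1) * det_rel k"
      by (simp add: det_rel_eq minus1 algebra_simps)
    then show ?thesis using det_ideal_closed by metis
  qed
  have S1: "sub_semiring ?S1"
    by (rule sub_semiring_adjoin[OF S0 t0 m0 rel])
  have S2: "sub_semiring ?S2"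
    by (rule sub_semiring_adjoin[OF S1 adjoin_base[OF S0 t0] adjoin_base[OF S0 m0] rel])
  have emb: "q \<in> ?S2" if "q \<in> ?S0" for q
    using that S0 S1 adjoin_base by blast
  have a2: "?a k \<in> ?S2" for k
    using exhaust_2[of k] adjoin_gen[OF S0] adjoin_gen[OF S1] adjoin_base[OF S1] by metis
  show ?thesis
  proof (induction p rule: cpoly_induct)
    case (Const c)
    show ?case by (rule emb[OF C0])
  next
    case (Var v)
    have d: "Var (k, 2, 2) = ?t k + Const (- 1) * ?a k" for k
      by (simp add: minus1)
    have "?t k + Const (- 1) * ?a k \<in> ?S2" for k
      using S2 emb[OF t0[of k]] emb[OF C0[of "- 1"]] a2[of k]
      unfolding sub_semiring_def by blast
    then have "Var (k, 2, 2) \<in> ?S2" for k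
      unfolding d[symmetric] .
    then have "Var (k, i, j) \<in> ?S2" for k i j
      using exhaust_2[of i] exhaust_2[of j] a2[of k] emb[OF off0(1)[of k]] emb[OF off0(2)[of k]]
      by auto
    then show ?case by (cases v) simp
  next
    case (add p q)
    then show ?case using S2 unfolding sub_semiring_def by blast
  next
    case (mult p q)
    then show ?case using S2 unfolding sub_semiring_def by blast
  qed
qed

lemma affine_zero_twice:
  fixes u v a b :: complex
  assumes "u + v * a = 0" "u + v * b = 0" "a \<noteq> b"
  shows "u = 0" "v = 0"
proof -
  have "v * (a - b) = (u + v * a) - (u + v * b)"
    by (simp add: algebra_simps)
  then show "v = 0" using assms by simp
  then show "u = 0" using assms by simp
qed

lemma two_roots:
  fixes t n :: complex
  assumes "t * t - 4 * n \<noteq> 0"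
  obtains a b where "a \<noteq> b" "a * (t - a) = n" "b * (t - b) = n"
proof -
  let ?d = "csqrt (t * t - 4 * n)"
  have d: "?d * ?d = t * t - 4 * n"
    using power2_csqrt by (simp add: power2_eq_square)
  then have "?d \<noteq> 0" using assms by auto
  show thesis
  proof (rule that[of "(t + ?d) / 2" "(t - ?d) / 2"])
    show "(t + ?d) / 2 \<noteq> (t - ?d) / 2"
      using \<open>?d \<noteq> 0\<close> by simp
    show "(t + ?d) / 2 * (t - (t + ?d) / 2) = n" "(t - ?d) / 2 * (t - (t - ?d) / 2) = n"
      using d by (simp_all add: field_simps)
  qed
qed

text \<open>The Nullstellensatz needed here, saying that the ideal is radical. For given traces and
  off-diagonal entries \<open>b\<close>, \<open>c\<close> the upper left entry \<open>a\<close> of a matrix of determinant \<open>1\<close> is a root of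
  \<open>a (t - a) = b c + 1\<close>. Where the discriminants of the two quadratic equations are nonzero, there
  are two choices for each of \<open>a\<close> and \<open>a'\<close>; the four resulting equations
  \<open>A + B a + C a' + D a a' = 0\<close> make the coefficients of the normal form vanish. So these vanish
  generically, hence identically.\<close>

lemma vanishing_imp_det_ideal:
  assumes "\<And>x. x \<in> SL2 \<times> SL2 \<Longrightarrow> value_at (entry_of x) p = 0"
  shows "p \<in> det_ideal"
proof -
  let ?a = "\<lambda>k :: 2. Var (k, 1, 1) :: entry cpoly"
  obtain P Q where PQ: "P \<in> adjoin (range (subst_cpoly trace_subst)) (?a 1)"
    "Q \<in> adjoin (range (subst_cpoly trace_subst)) (?a 1)"
    and p: "p - (P + Q * ?a 2) \<in> det_ideal"
    using adjoinE[OF entry_cpoly_normal_form[of p]] .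
  obtain A B where
    P: "P - (subst_cpoly trace_subst A + subst_cpoly trace_subst B * ?a 1) \<in> det_ideal"
    using PQ(1) by (elim adjoinE rangeE) blast
  obtain C D where
    Q: "Q - (subst_cpoly trace_subst C + subst_cpoly trace_subst D * ?a 1) \<in> det_ideal"
    using PQ(2) by (elim adjoinE rangeE) blast
  \<comment> \<open>The discriminant \<open>t\<^sup>2 - 4 (b c + 1)\<close> of the quadratic equation for \<open>a\<close>.\<close>
  define disc :: "2 \<Rightarrow> entry cpoly" where
    "disc k = (Var (k, 1, 1) + Var (k, 2, 2)) * (Var (k, 1, 1) + Var (k, 2, 2))
              - Const 4 * (Var (k, 1, 2) * Var (k, 2, 1) + 1)" for k
  have all0: "value_at s (subst_cpoly trace_subst A) = 0 \<and> value_at s (subst_cpoly trace_subst B) = 0 \<and>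
    value_at s (subst_cpoly trace_subst C) = 0 \<and> value_at s (subst_cpoly trace_subst D) = 0"
    if "value_at s (disc 1 * disc 2) \<noteq> 0" for s
  proof -
    define t where "t k = s (k, 1, 1) + s (k, 2, 2)" for k
    define n where "n k = s (k, 1, 2) * s (k, 2, 1) + 1" for k
    have "t 1 * t 1 - 4 * n 1 \<noteq> 0" "t 2 * t 2 - 4 * n 2 \<noteq> 0"
      using that by (auto simp: disc_def t_def n_def)
    note disc = this
    obtain a1 b1 where ab1: "a1 \<noteq> b1" "a1 * (t 1 - a1) = n 1" "b1 * (t 1 - b1) = n 1"
      using two_roots[OF disc(1)] .
    obtain a2 b2 where ab2: "a2 \<noteq> b2" "a2 * (t 2 - a2) = n 2" "b2 * (t 2 - b2) = n 2"
      using two_roots[OF disc(2)] .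
    define M :: "2 \<Rightarrow> complex \<Rightarrow> cmat2" where
      "M k r = (\<chi> i j. if i \<noteq> j then s (k, i, j) else if i = 1 then r else t k - r)" for k r
    have entries: "M k r $ 1 $ 1 = r" for k r
      by (simp add: M_def)
    let ?v = "\<lambda>R. value_at s (subst_cpoly trace_subst R)"
    have lin: "(?v A + ?v B * r1) + (?v C + ?v D * r1) * r2 = 0"
      if "r1 * (t 1 - r1) = n 1" "r2 * (t 2 - r2) = n 2" for r1 r2
    proof -
      let ?x = "(M 1 r1, M 2 r2)"
      have x: "?x \<in> SL2 \<times> SL2"
        using that by (simp add: SL2_def det_2 M_def n_def)
      have "(\<lambda>v. value_at (entry_of ?x) (trace_subst v)) = (\<lambda>v. value_at s (trace_subst v))"
      proof
        fix v :: entry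
        obtain k i j where "v = (k, i, j)" by (cases v)
        then show "value_at (entry_of ?x) (trace_subst v) = value_at s (trace_subst v)"
          using exhaust_2[of k] by (auto simp: M_def t_def)
      qed
      then have same: "value_at (entry_of ?x) (subst_cpoly trace_subst R) = ?v R" for R
        by (simp add: value_at_subst)
      have "value_at (entry_of ?x) p = 0"
        using assms x by blast
      moreover have "value_at (entry_of ?x) p
          = value_at (entry_of ?x) P + value_at (entry_of ?x) Q * r2"
        using det_ideal_vanishes[OF p x] by (simp add: entries)
      moreover have "value_at (entry_of ?x) P = ?v A + ?v B * r1"
        using det_ideal_vanishes[OF P x] by (simp add: entries same)
      moreover have "value_at (entry_of ?x) Q = ?v C + ?v D * r1"
        using det_ideal_vanishes[OF Q x] by (simp add: entries same)
      ultimately show ?thesis by metis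
    qed
    have inner: "?v A + ?v B * r1 = 0" "?v C + ?v D * r1 = 0" if "r1 * (t 1 - r1) = n 1" for r1
      by (rule affine_zero_twice[OF lin[OF that ab2(2)] lin[OF that ab2(3)] ab2(1)])+
    note AB = inner(1)[OF ab1(2)] inner(1)[OF ab1(3)]
    note CD = inner(2)[OF ab1(2)] inner(2)[OF ab1(3)]
    show ?thesis
      by (intro conjI affine_zero_twice[OF AB ab1(1)] affine_zero_twice[OF CD ab1(1)])
  qed
  \<comment> \<open>With all entries equal to \<open>1\<close> both discriminants are \<open>4 - 8\<close>.\<close>
  have "value_at (\<lambda>_. 1) (disc 1 * disc 2) \<noteq> 0"
    by (simp add: disc_def)
  note generic = cpoly_eq_0_if_generically_vanishing[where h = "disc 1 * disc 2", OF _ this]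
  note all0' = all0[THEN conjunct1] all0[THEN conjunct2, THEN conjunct1]
    all0[THEN conjunct2, THEN conjunct2, THEN conjunct1] all0[THEN conjunct2, THEN conjunct2, THEN conjunct2]
  have z: "subst_cpoly trace_subst A = 0" "subst_cpoly trace_subst B = 0"
    "subst_cpoly trace_subst C = 0" "subst_cpoly trace_subst D = 0"
    by (rule generic, erule all0')+
  have "P \<in> det_ideal" "Q \<in> det_ideal"
    using P Q by (simp_all add: z)
  then have "(p - (P + Q * ?a 2)) + (P + ?a 2 * Q) \<in> det_ideal"
    by (intro det_ideal_closed(2) det_ideal_closed(3) p)
  then show ?thesis by (simp add: mult.commute)
qed

section \<open>Polynomial curves in the special linear group\<close>

definition mat2 :: "'a \<Rightarrow> 'a \<Rightarrow> 'a \<Rightarrow> 'a \<Rightarrow> 'a ^ 2 ^ 2" where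
  "mat2 a b c d = (\<chi> i j. if i = 1 then (if j = 1 then a else b) else (if j = 1 then c else d))"

lemma mat2_nth [simp]:
  "mat2 a b c d $ 1 $ 1 = a" "mat2 a b c d $ 1 $ 2 = b"
  "mat2 a b c d $ 2 $ 1 = c" "mat2 a b c d $ 2 $ 2 = d"
  by (simp_all add: mat2_def)

lemma mat2_eq_iff [simp]:
  "mat2 a b c d = mat2 a' b' c' d' \<longleftrightarrow> a = a' \<and> b = b' \<and> c = c' \<and> d = d'"
  by (auto simp: vec_eq_iff forall_2)

lemma mat2_entries: "A = mat2 (A $ 1 $ 1) (A $ 1 $ 2) (A $ 2 $ 1) (A $ 2 $ 2)"
  by (simp add: vec_eq_iff forall_2)

lemma mat2_mult [simp]:
  fixes a b c d :: "'a::comm_ring_1"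
  shows "mat2 a b c d ** mat2 a' b' c' d'
       = mat2 (a * a' + b * c') (a * b' + b * d') (c * a' + d * c') (c * b' + d * d')"
  by (simp add: vec_eq_iff forall_2 matrix_matrix_mult_def sum_2)

lemma det_mat2 [simp]: "det (mat2 a b c d) = a * d - b * (c :: 'a::comm_ring_1)"
  by (simp add: det_2)

lemma trace_mat2 [simp]: "trace (mat2 a b c d) = a + (d :: 'a::comm_ring_1)"
  by (simp add: trace_def sum_2)

lemma mat_1_eq_mat2: "mat 1 = mat2 1 0 0 (1 :: 'a::comm_ring_1)"
  by (simp add: vec_eq_iff forall_2 mat_def)

lemma mat2_in_SL2 [simp]: "mat2 a b c d \<in> SL2 \<longleftrightarrow> a * d - b * c = 1"
  by (simp add: SL2_def)

lemma SL2_cases: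
  assumes "A \<in> SL2"
  obtains a b c d where "A = mat2 a b c d" "a * d - b * c = 1"
  using assms mat2_entries[of A] by (metis mat2_in_SL2)

lemma SL2_mult: "A \<in> SL2 \<Longrightarrow> B \<in> SL2 \<Longrightarrow> A ** B \<in> SL2"
  by (simp add: SL2_def det_mul)

lemma matrix_inv_SL2 [simp]:
  assumes "a * d - b * c = 1"
  shows "matrix_inv (mat2 a b c d) = (mat2 d (- b) (- c) a :: cmat2)"
proof -
  let ?A = "mat2 a b c d" and ?B = "mat2 d (- b) (- c) a :: cmat2"
  have AB: "?A ** ?B = mat 1" "?B ** ?A = mat 1"
    using assms by (simp_all add: mat_1_eq_mat2 algebra_simps)
  then have "?A ** matrix_inv ?A = mat 1"
    unfolding matrix_inv_def by (metis (mono_tags, lifting) someI_ex)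
  then have "?B ** (?A ** matrix_inv ?A) = ?B"
    by simp
  then show ?thesis
    by (simp add: matrix_mul_assoc AB del: mat2_mult)
qed

lemma SL2_inv:
  assumes "A \<in> SL2"
  shows "matrix_inv A \<in> SL2" "A ** matrix_inv A = mat 1" "matrix_inv A ** A = mat 1"
  using assms by (auto elim!: SL2_cases simp: mat_1_eq_mat2 algebra_simps)

lemma SL2_inv_unique:
  assumes "A \<in> SL2" "A ** B = mat 1"
  shows "matrix_inv A = B"
proof -
  have "matrix_inv A ** (A ** B) = B"
    using SL2_inv(3)[OF assms(1)] by (simp add: matrix_mul_assoc)
  then show ?thesis by (simp add: assms(2))
qed

lemma SL2_conj: "g \<in> SL2 \<Longrightarrow> A \<in> SL2 \<Longrightarrow> g ** A ** matrix_inv g \<in> SL2"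
  by (simp add: SL2_mult SL2_inv)

definition map_mat :: "('a \<Rightarrow> 'b) \<Rightarrow> 'a ^ 2 ^ 2 \<Rightarrow> 'b ^ 2 ^ 2" where
  "map_mat h A = (\<chi> i j. h (A $ i $ j))"

lemma map_mat_nth [simp]: "map_mat h A $ i $ j = h (A $ i $ j)"
  by (simp add: map_mat_def)

lemma map_mat_mat2 [simp]: "map_mat h (mat2 a b c d) = mat2 (h a) (h b) (h c) (h d)"
  by (simp add: vec_eq_iff forall_2)

lemma map_mat_poly_mult:
  "map_mat (\<lambda>p. poly p t) (M ** N)
   = map_mat (\<lambda>p. poly p t) M ** map_mat (\<lambda>p. poly p (t :: complex)) N"
  by (simp add: vec_eq_iff matrix_matrix_mult_def poly_sum)

lemma map_mat_poly_const: "map_mat (\<lambda>p. poly p t) (map_mat (\<lambda>c. [:c:]) A) = (A :: cmat2)"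
  by (simp add: vec_eq_iff)

text \<open>Three elementary factors suffice for a matrix with nonzero lower left entry, which becomes
  the parameter of the middle factor. The leftmost factor serves to make this entry nonzero.\<close>

lemma SL2_elementary_product:
  assumes "A \<in> SL2"
  obtains u1 u2 u3 u4 where
    "A = mat2 1 0 u1 1 ** mat2 1 u2 0 1 ** mat2 1 0 u3 1 ** mat2 1 u4 0 1"
proof -
  obtain a b c d where A: "A = mat2 a b c d" and det: "a * d - b * c = 1"
    using assms by (rule SL2_cases)
  define u1 :: complex where "u1 = (if c = 0 then 1 else 0)"
  define u3 where "u3 = c - u1 * a"
  have "u3 \<noteq> 0"
    using det by (auto simp: u3_def u1_def)
  define u2 where "u2 = (a - 1) / u3"
  define u4 where "u4 = (d - u1 * b - 1) / u3"
  have 2: "u2 * u3 = a - 1" and 4: "u3 * u4 = d - u1 * b - 1"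
    using \<open>u3 \<noteq> 0\<close> by (simp_all add: u2_def u4_def)
  have "u3 * (u2 + u4 + u2 * u3 * u4) = u3 * b"
  proof -
    have "u3 * (u2 + u4 + u2 * u3 * u4) = (u2 * u3) + (u3 * u4) + (u2 * u3) * (u3 * u4)"
      by (simp add: algebra_simps)
    also have "\<dots> = u3 * b"
      unfolding 2 4 using det by (simp add: u3_def algebra_simps)
    finally show ?thesis .
  qed
  then have b: "u2 + u4 + u2 * u3 * u4 = b"
    using \<open>u3 \<noteq> 0\<close> by simp
  have "A = mat2 1 0 u1 1 ** mat2 1 u2 0 1 ** mat2 1 0 u3 1 ** mat2 1 u4 0 1"
  proof -
    have "a = 1 + u2 * u3" using 2 by simp
    moreover have "c = u1 + (1 + u1 * u2) * u3"
    proof -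
      have "u1 + (1 + u1 * u2) * u3 = u1 + u3 + u1 * (u2 * u3)" by (simp add: algebra_simps)
      then show ?thesis unfolding 2 by (simp add: u3_def algebra_simps)
    qed
    moreover have "d = u1 * u4 + (1 + u1 * u2) * (1 + u3 * u4)"
    proof -
      have "u1 * u4 + (1 + u1 * u2) * (1 + u3 * u4)
          = u1 * (u2 + u4 + u2 * u3 * u4) + (1 + u3 * u4)" by (simp add: algebra_simps)
      then show ?thesis unfolding b 4 by simp
    qed
    ultimately show ?thesis
      using b by (simp add: A algebra_simps)
  qed
  then show thesis by (rule that)
qed

text \<open>Scaling the parameters of the elementary factors of \<open>B A\<^sup>-\<^sup>1\<close> by \<open>t\<close> gives a polynomial curve
  from the identity to \<open>B A\<^sup>-\<^sup>1\<close>; multiply it by \<open>A\<close> on the right.\<close>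

lemma SL2_polynomial_curve:
  assumes "A \<in> SL2" "B \<in> SL2"
  obtains M :: "complex poly ^ 2 ^ 2" where
    "\<forall>t. map_mat (\<lambda>p. poly p t) M \<in> SL2"
    "map_mat (\<lambda>p. poly p 0) M = A" "map_mat (\<lambda>p. poly p 1) M = B"
proof -
  obtain u1 u2 u3 u4 where
    u: "B ** matrix_inv A = mat2 1 0 u1 1 ** mat2 1 u2 0 1 ** mat2 1 0 u3 1 ** mat2 1 u4 0 1"
    using SL2_elementary_product[OF SL2_mult[OF assms(2) SL2_inv(1)[OF assms(1)]]] .
  define M where "M = mat2 1 0 [:0, u1:] 1 ** mat2 1 [:0, u2:] 0 1 ** mat2 1 0 [:0, u3:] 1
    ** mat2 1 [:0, u4:] 0 1 ** map_mat (\<lambda>c. [:c:]) A"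
  have M: "map_mat (\<lambda>p. poly p t) M
      = mat2 1 0 (t * u1) 1 ** mat2 1 (t * u2) 0 1 ** mat2 1 0 (t * u3) 1 ** mat2 1 (t * u4) 0 1 ** A" for t
    by (simp add: M_def map_mat_poly_mult map_mat_poly_const del: mat2_mult)
  show thesis
  proof (rule that[of M])
    show "\<forall>t. map_mat (\<lambda>p. poly p t) M \<in> SL2"
      unfolding M by (intro allI SL2_mult assms) simp_all
    show "map_mat (\<lambda>p. poly p 0) M = A"
      unfolding M by (simp flip: mat_1_eq_mat2)
    have "map_mat (\<lambda>p. poly p 1) M = B ** matrix_inv A ** A"
      unfolding M u by simp
    also have "\<dots> = B"
      using SL2_inv(3)[OF assms(1)] by (simp add: matrix_mul_assoc[symmetric])
    finally show "map_mat (\<lambda>p. poly p 1) M = B" .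
  qed
qed

text \<open>The locus \<open>h \<noteq> 0\<close> is Zariski dense in the variety of pairs once it is nonempty, because any two
  pairs are joined by a polynomial curve.\<close>

lemma zero_on_SL2_pairs_if_generically_zero:
  assumes zero: "\<And>x. x \<in> SL2 \<times> SL2 \<Longrightarrow> value_at (entry_of x) h \<noteq> 0 \<Longrightarrow> value_at (entry_of x) p = 0"
    and "x0 \<in> SL2 \<times> SL2" "value_at (entry_of x0) h \<noteq> 0" and "x \<in> SL2 \<times> SL2"
  shows "value_at (entry_of x) p = 0"
proof -
  obtain A B where x: "x = (A, B)" "A \<in> SL2" "B \<in> SL2" using assms(4) by blast
  obtain A0 B0 where x0: "x0 = (A0, B0)" "A0 \<in> SL2" "B0 \<in> SL2" using assms(2) by blast
  obtain M where M: "\<forall>t. map_mat (\<lambda>p. poly p t) M \<in> SL2"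
    "map_mat (\<lambda>p. poly p 0) M = A" "map_mat (\<lambda>p. poly p 1) M = A0"
    using SL2_polynomial_curve[OF x(2) x0(2)] .
  obtain N where N: "\<forall>t. map_mat (\<lambda>p. poly p t) N \<in> SL2"
    "map_mat (\<lambda>p. poly p 0) N = B" "map_mat (\<lambda>p. poly p 1) N = B0"
    using SL2_polynomial_curve[OF x(3) x0(3)] .
  define P :: "entry \<Rightarrow> complex poly" where
    "P = (\<lambda>(k, i, j). (if k = 1 then M else N) $ i $ j)"
  have P: "(\<lambda>v. poly (P v) t) = entry_of (map_mat (\<lambda>p. poly p t) M, map_mat (\<lambda>p. poly p t) N)" for t
    by (auto simp: P_def fun_eq_iff)
  have "value_at (\<lambda>v. poly (P v) 0) p = 0"
  proof (rule zero_along_curve[where h = h and ?t0.0 = 1])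
    show "value_at (\<lambda>v. poly (P v) t) h \<noteq> 0 \<Longrightarrow> value_at (\<lambda>v. poly (P v) t) p = 0" for t
      unfolding P by (rule zero) (use M N in auto)
    show "value_at (\<lambda>v. poly (P v) 1) h \<noteq> 0"
      unfolding P using assms(3) by (simp add: M N x0)
  qed
  then show ?thesis by (simp add: P M N x)
qed

section \<open>A section of the trace map\<close>

text \<open>With \<open>M\<close> the product of the first matrix and the inverse of the second, the first basis vector
  is an eigenvector of \<open>M\<close> for the eigenvalue \<open>1 / \<zeta>\<close>, so \<open>M\<close> has trace \<open>\<zeta> + 1 / \<zeta>\<close>. The second
  basis vector is chosen so that the first matrix becomes a companion matrix.\<close>

definition section_pair :: "complex \<Rightarrow> complex \<Rightarrow> complex \<Rightarrow> cmat2 \<times> cmat2" where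
  "section_pair x y \<zeta> = (mat2 x (- 1) 1 0, mat2 y (- \<zeta>) (1 / \<zeta>) 0)"

lemma section_pair_in_SL2: "\<zeta> \<noteq> 0 \<Longrightarrow> section_pair x y \<zeta> \<in> SL2 \<times> SL2"
  by (simp add: section_pair_def)

lemma trace_coords_mat2:
  assumes "a' * d' - b' * c' = 1"
  shows "trace_coords (mat2 a b c d, mat2 a' b' c' d')
       = (\<lambda>v. case v of t_x \<Rightarrow> a + d | t_y \<Rightarrow> a' + d' | t_z \<Rightarrow> a * d' - b * c' - c * b' + d * a')"
proof
  fix v
  show "trace_coords (mat2 a b c d, mat2 a' b' c' d') v
      = (case v of t_x \<Rightarrow> a + d | t_y \<Rightarrow> a' + d' | t_z \<Rightarrow> a * d' - b * c' - c * b' + d * a')"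
    using assms by (cases v) (simp_all add: algebra_simps)
qed

lemma trace_coords_section_pair:
  assumes "\<zeta> \<noteq> 0"
  shows "trace_coords (section_pair x y \<zeta>)
       = (\<lambda>v. case v of t_x \<Rightarrow> x | t_y \<Rightarrow> y | t_z \<Rightarrow> \<zeta> + 1 / \<zeta>)"
  using assms
  by (auto simp: section_pair_def trace_coords_mat2 fun_eq_iff split: tvar.split)

lemma reciprocal_sum:
  obtains \<zeta> :: complex where "\<zeta> \<noteq> 0" "\<zeta> + 1 / \<zeta> = z"
proof -
  let ?d = "csqrt (z * z - 4)"
  let ?u = "(z + ?d) / 2"
  have d: "?d * ?d = z * z - 4"
    using power2_csqrt by (simp add: power2_eq_square)
  have q: "?u * (z - ?u) = 1"
  proof -
    have "?u * (z - ?u) = (z * z - ?d * ?d) / 4" by (simp add: field_simps)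
    then show ?thesis unfolding d by simp
  qed
  then have "?u \<noteq> 0" by auto
  then have "1 / ?u = z - ?u"
    using nonzero_mult_div_cancel_left[of ?u "z - ?u"] unfolding q by blast
  then have "?u + 1 / ?u = z"
    by (metis add.commute diff_add_cancel)
  with \<open>?u \<noteq> 0\<close> show thesis by (rule that)
qed

lemma trace_coords_surj:
  obtains A B where "A \<in> SL2" "B \<in> SL2" "trace_coords (A, B) = s"
proof -
  obtain \<zeta> where z: "\<zeta> \<noteq> 0" "\<zeta> + 1 / \<zeta> = s t_z"
    using reciprocal_sum .
  have "trace_coords (section_pair (s t_x) (s t_y) \<zeta>) = s"
    unfolding trace_coords_section_pair[OF z(1)] using z(2) by (auto simp: fun_eq_iff split: tvar.split)
  with section_pair_in_SL2[OF z(1), of "s t_x" "s t_y"] show thesis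
    by (cases "section_pair (s t_x) (s t_y) \<zeta>") (auto intro: that)
qed

text \<open>The entries of the section pair are polynomials in \<open>x\<close>, \<open>y\<close>, \<open>\<zeta>\<close> and \<open>1 / \<zeta>\<close>. With
  \<open>z = \<zeta> + 1 / \<zeta>\<close> one has \<open>1 / \<zeta> = z - \<zeta>\<close> and \<open>\<zeta>\<^sup>2 = z \<zeta> - 1\<close>, so they generate a ring whose elements
  are linear in \<open>\<zeta>\<close> over the polynomials in the traces.\<close>

lemma value_on_section:
  fixes p :: "entry cpoly"
  obtains Q R :: "tvar cpoly" where
    "\<forall>x y \<zeta>. \<zeta> \<noteq> 0 \<longrightarrow> value_at (entry_of (section_pair x y \<zeta>)) p
       = value_at (trace_coords (section_pair x y \<zeta>)) Q
         + \<zeta> * value_at (trace_coords (section_pair x y \<zeta>)) R"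
proof -
  let ?E = "\<lambda>x y \<zeta>. entry_of (section_pair x y \<zeta>)"
  let ?T = "\<lambda>x y \<zeta>. trace_coords (section_pair x y \<zeta>)"
  have "\<exists>Q R. \<forall>x y \<zeta>. \<zeta> \<noteq> 0 \<longrightarrow>
    value_at (?E x y \<zeta>) p = value_at (?T x y \<zeta>) Q + \<zeta> * value_at (?T x y \<zeta>) R"
  proof (induction p rule: cpoly_induct)
    case (Const c)
    show ?case
      by (rule exI[where x = "Const c"], rule exI[where x = 0]) simp
  next
    case (Var v)
    obtain k i j where v: "v = (k, i, j)" by (cases v)
    consider "v = (1, 1, 1)" | "v = (1, 1, 2)" | "v = (1, 2, 1)" | "v = (1, 2, 2)"
      | "v = (2, 1, 1)" | "v = (2, 1, 2)" | "v = (2, 2, 1)" | "v = (2, 2, 2)"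
      using exhaust_2[of k] exhaust_2[of i] exhaust_2[of j] v by metis
    then show ?case
    proof cases
      case 1
      show ?thesis
        by (rule exI[where x = "Var t_x"], rule exI[where x = 0])
          (simp add: 1 trace_coords_section_pair, simp add: section_pair_def)
    next
      case 2
      show ?thesis
        by (rule exI[where x = "- 1"], rule exI[where x = 0]) (simp add: 2 section_pair_def)
    next
      case 3
      show ?thesis
        by (rule exI[where x = 1], rule exI[where x = 0]) (simp add: 3 section_pair_def)
    next
      case 4
      show ?thesis
        by (rule exI[where x = 0], rule exI[where x = 0]) (simp add: 4 section_pair_def)
    next
      case 5
      show ?thesis
        by (rule exI[where x = "Var t_y"], rule exI[where x = 0])
          (simp add: 5 trace_coords_section_pair, simp add: section_pair_def)
    next
      case 6
      show ?thesis
        by (rule exI[where x = 0], rule exI[where x = "- 1"]) (simp add: 6 section_pair_def)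
    next
      case 7
      show ?thesis
        by (rule exI[where x = "Var t_z"], rule exI[where x = "- 1"])
          (simp add: 7 trace_coords_section_pair, simp add: section_pair_def)
    next
      case 8
      show ?thesis
        by (rule exI[where x = 0], rule exI[where x = 0]) (simp add: 8 section_pair_def)
    qed
  next
    case (add p p')
    then obtain Q R Q' R' where
      "\<forall>x y \<zeta>. \<zeta> \<noteq> 0 \<longrightarrow> value_at (?E x y \<zeta>) p = value_at (?T x y \<zeta>) Q + \<zeta> * value_at (?T x y \<zeta>) R"
      "\<forall>x y \<zeta>. \<zeta> \<noteq> 0 \<longrightarrow> value_at (?E x y \<zeta>) p' = value_at (?T x y \<zeta>) Q' + \<zeta> * value_at (?T x y \<zeta>) R'"
      by blast
    then show ?case
      by (intro exI[where x = "Q + Q'"] exI[where x = "R + R'"]) (simp add: algebra_simps)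
  next
    case (mult p p')
    then obtain Q R Q' R' where *:
      "\<forall>x y \<zeta>. \<zeta> \<noteq> 0 \<longrightarrow> value_at (?E x y \<zeta>) p = value_at (?T x y \<zeta>) Q + \<zeta> * value_at (?T x y \<zeta>) R"
      "\<forall>x y \<zeta>. \<zeta> \<noteq> 0 \<longrightarrow> value_at (?E x y \<zeta>) p' = value_at (?T x y \<zeta>) Q' + \<zeta> * value_at (?T x y \<zeta>) R'"
      by blast
    have step: "(q + u * r) * (q' + u * r')
        = (q * q' - r * r') + u * (q * r' + r * q' + (u + 1 / u) * (r * r'))"
      if "u \<noteq> 0" for q r q' r' u :: complex
      using that by (simp add: algebra_simps)
    have "value_at (?E x y \<zeta>) (p * p') = value_at (?T x y \<zeta>) (Q * Q' - R * R')
      + \<zeta> * value_at (?T x y \<zeta>) (Q * R' + R * Q' + Var t_z * (R * R'))" if "\<zeta> \<noteq> 0" for x y \<zeta>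
    proof -
      have "?T x y \<zeta> t_z = \<zeta> + 1 / \<zeta>"
        by (simp add: trace_coords_section_pair that)
      then show ?thesis
        using * that step[OF that] by simp
    qed
    then show ?case by blast
  qed
  then show thesis using that by blast
qed

section \<open>Conjugating a generic pair into the section\<close>

lemma kernel_vector:
  fixes a b c d :: complex
  assumes "a * d - b * c = 0"
  obtains v w where "v \<noteq> 0 \<or> w \<noteq> 0" "a * v + b * w = 0" "c * v + d * w = 0"
proof (cases "a = 0 \<and> b = 0")
  case True
  show thesis
  proof (cases "c = 0 \<and> d = 0")
    case True
    with \<open>a = 0 \<and> b = 0\<close> show thesis by (intro that[of 1 0]) simp_all
  next
    case False
    with \<open>a = 0 \<and> b = 0\<close> show thesis by (intro that[of d "- c"]) auto
  qed
next
  case False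
  with assms show thesis by (intro that[of b "- a"]) (auto simp: algebra_simps)
qed

text \<open>The second hypothesis says that \<open>(v, w)\<close> and its image under the matrix are linearly
  dependent.\<close>

lemma eigenvector_if_dependent:
  fixes a b c d v w :: complex
  assumes "v \<noteq> 0 \<or> w \<noteq> 0" and "v * (c * v + d * w) = w * (a * v + b * w)"
  obtains \<mu> where "a * v + b * w = \<mu> * v" "c * v + d * w = \<mu> * w"
proof (cases "v = 0")
  case True
  with assms show thesis by (intro that[of "(c * v + d * w) / w"]) auto
next
  case False
  then have ratio: "x = x / v * v" "v * y = w * x \<Longrightarrow> y = x / v * w" for x y
    by (auto simp: field_simps)
  show thesis
    by (rule that[OF ratio(1) ratio(2)[OF assms(2)]])
qed

text \<open>The commutator kills a common eigenvector. Nonvanishing of its determinant is the genericity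
  condition below: it is a polynomial condition that excludes common eigenvectors.\<close>

lemma det_commutator_eq_0_if_common_eigenvector:
  fixes a b c d e f p q :: complex
  assumes nz: "v \<noteq> 0 \<or> w \<noteq> 0"
    and A: "v * (c * v + d * w) = w * (a * v + b * w)"
    and B: "v * (p * v + q * w) = w * (e * v + f * w)"
  shows "det (mat2 a b c d ** mat2 e f p q - mat2 e f p q ** mat2 a b c d) = 0"
proof -
  obtain \<mu> where \<mu>: "a * v + b * w = \<mu> * v" "c * v + d * w = \<mu> * w"
    using eigenvector_if_dependent[OF nz A] .
  obtain \<nu> where \<nu>: "e * v + f * w = \<nu> * v" "p * v + q * w = \<nu> * w"
    using eigenvector_if_dependent[OF nz B] .
  \<comment> \<open>The commutator is the matrix with rows \<open>(k, l)\<close> and \<open>(m, - k)\<close>.\<close>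
  define k l m where "k = b * p - f * c" and "l = f * (a - d) - b * (e - q)" and "m = c * (e - q) - p * (a - d)"
  have "k * v + l * w
      = (a * (e * v + f * w) + b * (p * v + q * w)) - (e * (a * v + b * w) + f * (c * v + d * w))"
    by (simp add: k_def l_def algebra_simps)
  also have "\<dots> = \<nu> * (a * v + b * w) - \<mu> * (e * v + f * w)"
    unfolding \<mu>(2) \<nu>(2) by (subst \<mu>(1), subst \<nu>(1)) (simp add: algebra_simps)
  finally have 1: "k * v + l * w = 0"
    unfolding \<mu>(1) \<nu>(1) by simp
  have "m * v - k * w
      = (c * (e * v + f * w) + d * (p * v + q * w)) - (p * (a * v + b * w) + q * (c * v + d * w))"
    by (simp add: k_def m_def algebra_simps)
  also have "\<dots> = \<nu> * (c * v + d * w) - \<mu> * (p * v + q * w)"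
    unfolding \<mu>(1) \<nu>(1) by (subst \<mu>(2), subst \<nu>(2)) (simp add: algebra_simps)
  finally have 2: "m * v - k * w = 0"
    unfolding \<mu>(2) \<nu>(2) by simp
  have "(k * k + l * m) * v = k * (k * v + l * w) + l * (m * v - k * w)"
    "(k * k + l * m) * w = m * (k * v + l * w) - k * (m * v - k * w)"
    by (simp_all add: algebra_simps)
  then have "(k * k + l * m) * v = 0" "(k * k + l * m) * w = 0"
    unfolding 1 2 by simp_all
  then have "k * k + l * m = 0" using nz by auto
  then show ?thesis
    by (simp add: det_2 k_def l_def m_def algebra_simps)
qed

text \<open>The basis is forced by the shape of the section: its first vector \<open>V\<close> is an eigenvector of
  \<open>A B\<^sup>-\<^sup>1\<close> for \<open>1 / \<zeta>\<close>, its second vector is \<open>A V - x V\<close> with \<open>x\<close> the trace of \<open>A\<close>, which is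
  \<open>- A\<^sup>-\<^sup>1 V\<close>. They are independent, because otherwise \<open>V\<close> would be an eigenvector of both \<open>A\<close> and
  \<open>B\<close>. Scaling \<open>V\<close> by a square root then gives the base change determinant \<open>1\<close>. That both
  matrices take the required form is the Cayley-Hamilton identity.\<close>

lemma conjugate_to_section:
  assumes A: "A \<in> SL2" and B: "B \<in> SL2" and generic: "det (A ** B - B ** A) \<noteq> 0"
    and \<zeta>: "\<zeta> \<noteq> 0" "\<zeta> + 1 / \<zeta> = trace_coords (A, B) t_z"
  obtains g where "g \<in> SL2"
    "section_pair (trace A) (trace B) \<zeta> = (g ** A ** matrix_inv g, g ** B ** matrix_inv g)"
proof -
  obtain a b c d where A_eq: "A = mat2 a b c d" and detA: "a * d - b * c = 1"
    using A by (rule SL2_cases)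
  obtain e f p q where B_eq: "B = mat2 e f p q" and detB: "e * q - f * p = 1"
    using B by (rule SL2_cases)
  have tz: "\<zeta> + 1 / \<zeta> = a * q - b * p - c * f + d * e"
    using \<zeta>(2) unfolding A_eq B_eq trace_coords_mat2[OF detB] by simp
  \<comment> \<open>The eigenvector equation \<open>A B\<^sup>-\<^sup>1 V = V / \<zeta>\<close>, multiplied by \<open>\<zeta> A\<^sup>-\<^sup>1\<close>, says that
      \<open>\<zeta> B\<^sup>-\<^sup>1 - A\<^sup>-\<^sup>1\<close> kills \<open>V\<close>. The determinant of this matrix is \<open>\<zeta>\<^sup>2 + 1 - \<zeta> z\<close>.\<close>
  have "(\<zeta> * q - d) * (\<zeta> * e - a) - (b - \<zeta> * f) * (c - \<zeta> * p)
      = \<zeta> * \<zeta> * (e * q - f * p) + (a * d - b * c) - \<zeta> * (a * q - b * p - c * f + d * e)"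
    by (simp add: algebra_simps)
  also have "\<dots> = 0"
    unfolding detA detB tz[symmetric] using \<zeta>(1) by (simp add: algebra_simps)
  finally obtain v w where vw: "v \<noteq> 0 \<or> w \<noteq> 0"
    and 1: "(\<zeta> * q - d) * v + (b - \<zeta> * f) * w = 0" and 2: "(c - \<zeta> * p) * v + (\<zeta> * e - a) * w = 0"
    by (rule kernel_vector)
  \<comment> \<open>The determinant of the matrix with columns \<open>V\<close> and \<open>- A\<^sup>-\<^sup>1 V\<close>, before scaling.\<close>
  define \<delta> where "\<delta> = v * (c * v - a * w) - w * (b * w - d * v)"
  have "\<delta> \<noteq> 0"
  proof
    assume "\<delta> = 0"
    then have dA: "v * (c * v + d * w) = w * (a * v + b * w)"
      by (simp add: \<delta>_def algebra_simps)
    have col: "c * v - a * w = \<zeta> * (p * v - e * w)" "b * w - d * v = \<zeta> * (f * w - q * v)"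
      using 1 2 by (simp_all add: algebra_simps)
    have "\<delta> = \<zeta> * (v * (p * v - e * w) - w * (f * w - q * v))"
      unfolding \<delta>_def col by (simp add: algebra_simps)
    then have "v * (p * v - e * w) - w * (f * w - q * v) = 0"
      using \<open>\<delta> = 0\<close> \<zeta>(1) by simp
    then have dB: "v * (p * v + q * w) = w * (e * v + f * w)"
      by (simp add: algebra_simps)
    show False
      using generic det_commutator_eq_0_if_common_eigenvector[OF vw dA dB]
      unfolding A_eq B_eq by blast
  qed
  define s where "s = csqrt (1 / \<delta>)"
  have s: "s * s * \<delta> = 1"
    using power2_csqrt[of "1 / \<delta>"] \<open>\<delta> \<noteq> 0\<close> by (simp add: s_def power2_eq_square)
  define V W where "V = s * v" and "W = s * w"
  define V' W' where "V' = b * W - d * V" and "W' = c * V - a * W"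
  have det: "V * W' - V' * W = 1"
  proof -
    have "V * W' - V' * W = s * s * \<delta>"
      by (simp add: V_def W_def V'_def W'_def \<delta>_def algebra_simps)
    then show ?thesis using s by simp
  qed
  have V': "V' = \<zeta> * (f * W - q * V)" and W': "W' = \<zeta> * (p * V - e * W)"
  proof -
    have "s * ((\<zeta> * q - d) * v + (b - \<zeta> * f) * w) = 0" "s * ((c - \<zeta> * p) * v + (\<zeta> * e - a) * w) = 0"
      unfolding 1 2 by simp_all
    then show "V' = \<zeta> * (f * W - q * V)" "W' = \<zeta> * (p * V - e * W)"
      by (simp_all add: V_def W_def V'_def W'_def algebra_simps)
  qed
  define P where "P = mat2 V V' W W'"
  have P: "P \<in> SL2"
    using det by (simp add: P_def)
  define S T where "S = mat2 (a + d) (- 1) 1 0" and "T = mat2 (e + q) (- \<zeta>) (1 / \<zeta>) 0"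
  have "A ** P = P ** S"
  proof -
    have "a * V' + b * W' = - ((a * d - b * c) * V)" "c * V' + d * W' = - ((a * d - b * c) * W)"
      by (simp_all add: V'_def W'_def algebra_simps)
    then have "a * V' + b * W' = - V" "c * V' + d * W' = - W"
      unfolding detA by simp_all
    moreover have "a * V + b * W = V * (a + d) + V'" "c * V + d * W = W * (a + d) + W'"
      by (simp_all add: V'_def W'_def algebra_simps)
    ultimately show ?thesis
      by (simp add: A_eq P_def S_def)
  qed
  moreover have "B ** P = P ** T"
  proof -
    have "e * V' + f * W' = - (\<zeta> * ((e * q - f * p) * V))" "p * V' + q * W' = - (\<zeta> * ((e * q - f * p) * W))"
      unfolding V' W' by (simp_all add: algebra_simps)
    then have "e * V' + f * W' = - (\<zeta> * V)" "p * V' + q * W' = - (\<zeta> * W)"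
      unfolding detB by simp_all
    moreover have "e * V + f * W = V * (e + q) + V' / \<zeta>" "p * V + q * W = W * (e + q) + W' / \<zeta>"
      using \<zeta>(1) unfolding V' W' by (simp_all add: algebra_simps)
    ultimately show ?thesis
      by (simp add: B_eq P_def T_def mult.commute)
  qed
  ultimately have "matrix_inv P ** A ** P = S" "matrix_inv P ** B ** P = T"
    using SL2_inv(3)[OF P] by (simp_all add: matrix_mul_assoc[symmetric])
      (simp_all add: matrix_mul_assoc)
  moreover have "matrix_inv (matrix_inv P) = P"
    by (rule SL2_inv_unique[OF SL2_inv(1)[OF P] SL2_inv(3)[OF P]])
  ultimately show thesis
    using SL2_inv(1)[OF P] by (intro that[of "matrix_inv P"])
      (simp_all add: section_pair_def S_def T_def A_eq B_eq)
qed

section \<open>Invariant functions are polynomials in the traces\<close>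

fun trace_poly :: "tvar \<Rightarrow> entry cpoly" where
  "trace_poly t_x = Var (1, 1, 1) + Var (1, 2, 2)"
| "trace_poly t_y = Var (2, 1, 1) + Var (2, 2, 2)"
| "trace_poly t_z = Var (1, 1, 1) * Var (2, 2, 2) - Var (1, 1, 2) * Var (2, 2, 1)
    - Var (1, 2, 1) * Var (2, 1, 2) + Var (1, 2, 2) * Var (2, 1, 1)"

lemma value_at_trace_poly:
  assumes "x \<in> SL2 \<times> SL2"
  shows "value_at (entry_of x) (trace_poly v) = trace_coords x v"
proof -
  obtain A B where x: "x = (A, B)" and AB: "A \<in> SL2" "B \<in> SL2"
    using assms by blast
  obtain a b c d where A: "A = mat2 a b c d"
    using AB(1) by (rule SL2_cases)
  obtain a' b' c' d' where B: "B = mat2 a' b' c' d'" "a' * d' - b' * c' = 1"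
    using AB(2) by (rule SL2_cases)
  show ?thesis
    unfolding x A B(1) trace_coords_mat2[OF B(2)] by (cases v) simp_all
qed

lemma value_at_subst_trace_poly:
  assumes "x \<in> SL2 \<times> SL2"
  shows "value_at (entry_of x) (subst_cpoly trace_poly q) = value_at (trace_coords x) q"
  using value_at_trace_poly[OF assms] by (simp add: value_at_subst)

lemma trace_coords_conj:
  assumes "g \<in> SL2" "A \<in> SL2" "B \<in> SL2"
  shows "trace_coords (g ** A ** matrix_inv g, g ** B ** matrix_inv g) = trace_coords (A, B)"
proof -
  have conj: "trace (g ** M ** matrix_inv g) = trace M" for M
  proof -
    have "trace (g ** M ** matrix_inv g) = trace (matrix_inv g ** (g ** M))"
      by (rule trace_mul_sym)
    then show ?thesis
      using SL2_inv(3)[OF assms(1)] by (simp add: matrix_mul_assoc)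
  qed
  have cancel: "matrix_inv g ** (g ** M) = M" for M
    using SL2_inv(3)[OF assms(1)] by (simp add: matrix_mul_assoc)
  have "(g ** B ** matrix_inv g) ** (g ** matrix_inv B ** matrix_inv g) = g ** (B ** matrix_inv B) ** matrix_inv g"
    by (simp add: matrix_mul_assoc[symmetric] cancel)
  also have "\<dots> = mat 1"
    by (simp add: SL2_inv assms)
  finally have "matrix_inv (g ** B ** matrix_inv g) = g ** matrix_inv B ** matrix_inv g"
    by (rule SL2_inv_unique[OF SL2_conj[OF assms(1,3)]])
  then have "(g ** A ** matrix_inv g) ** matrix_inv (g ** B ** matrix_inv g)
      = g ** (A ** matrix_inv B) ** matrix_inv g"
    by (simp add: matrix_mul_assoc[symmetric] cancel)
  then have "trace_coords (g ** A ** matrix_inv g, g ** B ** matrix_inv g) v = trace_coords (A, B) v" for v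
    by (cases v) (simp_all add: conj)
  then show ?thesis by blast
qed

definition commutator_det :: "entry cpoly" where
  "commutator_det = det (gen_mat 1 ** gen_mat 2 - gen_mat 2 ** gen_mat 1)"

lemma value_at_commutator_det:
  "value_at (entry_of (A, B)) commutator_det = det (A ** B - B ** A)"
  by (simp add: commutator_det_def det_2 gen_mat_def matrix_matrix_mult_def sum_2)

text \<open>On the section an invariant \<open>p\<close> has the value \<open>Q + \<zeta> R\<close> with \<open>Q\<close>, \<open>R\<close> polynomials in the
  traces. A generic pair is conjugate to the section pairs for both \<open>\<zeta>\<close> and \<open>1 / \<zeta>\<close>, so \<open>p\<close> is
  also \<open>Q + R / \<zeta>\<close> there, and the mean of the two values is the polynomial \<open>Q + z R / 2\<close>. Being a
  polynomial identity, this extends from generic pairs to all pairs.\<close>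

lemma invariant_polynomial_in_traces:
  fixes p :: "entry cpoly"
  assumes inv: "\<And>g A B. g \<in> SL2 \<Longrightarrow> A \<in> SL2 \<Longrightarrow> B \<in> SL2 \<Longrightarrow>
      value_at (entry_of (g ** A ** matrix_inv g, g ** B ** matrix_inv g)) p = value_at (entry_of (A, B)) p"
  obtains q :: "tvar cpoly" where
    "\<forall>x\<in>SL2 \<times> SL2. value_at (entry_of x) p = value_at (trace_coords x) q"
proof -
  obtain Q R :: "tvar cpoly" where QR:
    "\<forall>x y \<zeta>. \<zeta> \<noteq> 0 \<longrightarrow> value_at (entry_of (section_pair x y \<zeta>)) p
       = value_at (trace_coords (section_pair x y \<zeta>)) Q
         + \<zeta> * value_at (trace_coords (section_pair x y \<zeta>)) R"
    by (rule value_on_section)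
  define q where "q = Q + Const (1 / 2) * Var t_z * R"
  have generic: "value_at (entry_of x) (p - subst_cpoly trace_poly q) = 0"
    if x: "x \<in> SL2 \<times> SL2" and nz: "value_at (entry_of x) commutator_det \<noteq> 0" for x
  proof -
    obtain A B where AB: "x = (A, B)" "A \<in> SL2" "B \<in> SL2" using x by blast
    let ?z = "trace_coords x t_z"
    have comm: "det (A ** B - B ** A) \<noteq> 0"
      using nz by (simp add: AB value_at_commutator_det)
    have at: "value_at (entry_of x) p = value_at (trace_coords x) Q + \<xi> * value_at (trace_coords x) R"
      if \<xi>: "\<xi> \<noteq> 0" "\<xi> + 1 / \<xi> = ?z" for \<xi>
    proof -
      let ?s = "section_pair (trace A) (trace B) \<xi>"
      obtain g where g: "g \<in> SL2" "?s = (g ** A ** matrix_inv g, g ** B ** matrix_inv g)"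
        using conjugate_to_section[OF AB(2,3) comm \<xi>(1) \<xi>(2)[unfolded AB(1)]] .
      have "trace_coords ?s = trace_coords x"
        unfolding g(2) AB(1) by (rule trace_coords_conj[OF g(1) AB(2,3)])
      moreover have "value_at (entry_of ?s) p = value_at (entry_of x) p"
        unfolding g(2) AB(1) by (rule inv[OF g(1) AB(2,3)])
      ultimately show ?thesis using QR \<xi>(1) by metis
    qed
    obtain \<zeta> where \<zeta>: "\<zeta> \<noteq> 0" "\<zeta> + 1 / \<zeta> = ?z"
      using reciprocal_sum .
    have "value_at (entry_of x) p = value_at (trace_coords x) Q + \<zeta> * value_at (trace_coords x) R"
      by (rule at[OF \<zeta>])
    moreover have "value_at (entry_of x) p = value_at (trace_coords x) Q + 1 / \<zeta> * value_at (trace_coords x) R"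
      by (rule at) (use \<zeta> in \<open>simp_all add: add.commute\<close>)
    ultimately have "2 * value_at (entry_of x) p
        = (value_at (trace_coords x) Q + \<zeta> * value_at (trace_coords x) R)
          + (value_at (trace_coords x) Q + 1 / \<zeta> * value_at (trace_coords x) R)"
      by (metis mult_2)
    also have "\<dots> = 2 * value_at (trace_coords x) Q + (\<zeta> + 1 / \<zeta>) * value_at (trace_coords x) R"
      by (simp add: algebra_simps)
    finally have "2 * value_at (entry_of x) p
        = 2 * value_at (trace_coords x) Q + ?z * value_at (trace_coords x) R"
      unfolding \<zeta>(2) .
    moreover have "u = w / 2" if "2 * u = w" for u w :: complex
      using that by auto
    ultimately have "value_at (entry_of x) p
        = (2 * value_at (trace_coords x) Q + ?z * value_at (trace_coords x) R) / 2"
      by blast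
    then have "value_at (entry_of x) p = value_at (trace_coords x) q"
      by (simp add: q_def add_divide_distrib)
    then show ?thesis by (simp add: value_at_subst_trace_poly[OF x])
  qed
  let ?x0 = "(mat2 0 (- 1) 1 0, mat2 1 1 0 1) :: cmat2 \<times> cmat2"
  have x0: "?x0 \<in> SL2 \<times> SL2" "value_at (entry_of ?x0) commutator_det \<noteq> 0"
    unfolding value_at_commutator_det by (simp_all add: det_2)
  have "value_at (entry_of x) (p - subst_cpoly trace_poly q) = 0" if "x \<in> SL2 \<times> SL2" for x
    by (rule zero_on_SL2_pairs_if_generically_zero[OF generic x0 that])
  then have "\<forall>x\<in>SL2 \<times> SL2. value_at (entry_of x) p = value_at (trace_coords x) q"
    by (simp add: value_at_subst_trace_poly)
  then show thesis by (rule that)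
qed

section \<open>The invariant ring\<close>

text \<open>By the description of the ideal as a vanishing ideal, the abstract coordinate ring is the ring
  of polynomial functions on pairs.\<close>

lemma residue_class_eq_iff:
  "residue_class p = residue_class q \<longleftrightarrow>
     (\<forall>x\<in>SL2 \<times> SL2. value_at (entry_of x) p = value_at (entry_of x) q)"
proof -
  interpret ideal det_ideal "cpoly_ring :: entry cpoly ring"
    by (rule ideal_det_ideal)
  have "residue_class p = residue_class q \<longleftrightarrow> p - q \<in> det_ideal"
    unfolding residue_class_def
    using quotient_eq_iff_same_a_r_cos[OF ideal_axioms, of p q] by (simp add: a_minus_def)
  also have "\<dots> \<longleftrightarrow> (\<forall>x\<in>SL2 \<times> SL2. value_at (entry_of x) (p - q) = 0)"
    using det_ideal_vanishes vanishing_imp_det_ideal by blast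
  finally show ?thesis by simp
qed

lemma carrier_coord_ring: "carrier coord_ring = range residue_class"
  by (auto simp: coord_ring_def FactRing_def A_RCOSETS_def' residue_class_def)

lemma residue_class_hom: "residue_class \<in> ring_hom cpoly_ring coord_ring"
proof -
  have "residue_class = (+>\<^bsub>cpoly_ring\<^esub>) det_ideal"
    by (simp add: residue_class_def fun_eq_iff)
  then show ?thesis
    unfolding coord_ring_def using ideal.rcos_ring_hom[OF ideal_det_ideal] by simp
qed

lemma mem_residue_class_iff: "q \<in> residue_class p \<longleftrightarrow> residue_class q = residue_class p"
proof -
  interpret ideal det_ideal "cpoly_ring :: entry cpoly ring"
    by (rule ideal_det_ideal)
  show ?thesis
    unfolding residue_class_def using a_rcos_self[of q] a_repr_independence[OF _ _ a_subgroup, of q p] by auto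
qed

lemma value_at_conj_subst:
  "value_at (entry_of (A, B)) (conj_subst g p)
   = value_at (entry_of (g ** A ** matrix_inv g, g ** B ** matrix_inv g)) p"
proof -
  have "value_at (entry_of (A, B)) (((\<chi> i j. Const (g $ i $ j)) ** gen_mat k **
          (\<chi> i j. Const (matrix_inv g $ i $ j))) $ i $ j)
      = entry_of (g ** A ** matrix_inv g, g ** B ** matrix_inv g) (k, i, j)" for k i j
    by (simp add: matrix_matrix_mult_def sum_2 gen_mat_def)
  then have "(\<lambda>v. value_at (entry_of (A, B)) ((\<lambda>(k, i, j). ((\<chi> i j. Const (g $ i $ j)) ** gen_mat k **
          (\<chi> i j. Const (matrix_inv g $ i $ j))) $ i $ j) v))
      = entry_of (g ** A ** matrix_inv g, g ** B ** matrix_inv g)"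
    by (auto simp: fun_eq_iff)
  then show ?thesis
    unfolding conj_subst_def value_at_subst by simp
qed

lemma conj_class_residue_class:
  assumes "g \<in> SL2"
  shows "conj_class g (residue_class p) = residue_class (conj_subst g p)"
proof -
  have "residue_class (conj_subst g q) = residue_class (conj_subst g p)" if "q \<in> residue_class p" for q
    using that SL2_conj[OF assms]
    by (auto simp: mem_residue_class_iff residue_class_eq_iff value_at_conj_subst)
  moreover have "p \<in> residue_class p"
    by (simp add: mem_residue_class_iff)
  ultimately show ?thesis
    unfolding conj_class_def by blast
qed

lemma carrier_invariant_ring:
  "carrier invariant_ring = {residue_class p | p. \<forall>g\<in>SL2. \<forall>A\<in>SL2. \<forall>B\<in>SL2.
     value_at (entry_of (g ** A ** matrix_inv g, g ** B ** matrix_inv g)) p = value_at (entry_of (A, B)) p}"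
proof -
  have "(\<forall>g\<in>SL2. conj_class g (residue_class p) = residue_class p) \<longleftrightarrow> (\<forall>g\<in>SL2. \<forall>A\<in>SL2. \<forall>B\<in>SL2.
     value_at (entry_of (g ** A ** matrix_inv g, g ** B ** matrix_inv g)) p = value_at (entry_of (A, B)) p)" for p
    by (auto simp: conj_class_residue_class residue_class_eq_iff value_at_conj_subst)
  then show ?thesis
    unfolding invariant_ring_def carrier_coord_ring by auto
qed

text \<open>Algebraic independence of the three traces: the trace map is onto the affine space, so a
  polynomial in the traces is determined by its values on pairs.\<close>

lemma tvar_cpoly_eqI:
  assumes "\<forall>A\<in>SL2. \<forall>B\<in>SL2. value_at (trace_coords (A, B)) q = value_at (trace_coords (A, B)) r"
  shows "q = r"
proof -
  have "value_at s (q - r) = 0" for s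
  proof -
    obtain A B where "A \<in> SL2" "B \<in> SL2" "trace_coords (A, B) = s"
      by (rule trace_coords_surj)
    then show ?thesis using assms by (metis eq_iff_diff_eq_0 value_at.eval_diff)
  qed
  then have "q - r = 0" by (rule cpoly_eq_0_if_vanishing)
  then show ?thesis by simp
qed

definition trace_class :: "tvar cpoly \<Rightarrow> entry cpoly set" where
  "trace_class q = residue_class (subst_cpoly trace_poly q)"

lemma trace_class_hom: "trace_class \<in> ring_hom cpoly_ring invariant_ring"
proof (rule ring_hom_memI)
  note hom = residue_class_hom[THEN ring_hom_mult] residue_class_hom[THEN ring_hom_add]
    residue_class_hom[THEN ring_hom_one]
  fix q r :: "tvar cpoly"
  show "trace_class q \<in> carrier invariant_ring"
    unfolding carrier_invariant_ring trace_class_def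
    by (auto intro!: exI[where x = "subst_cpoly trace_poly q"]
        simp: value_at_subst_trace_poly SL2_conj trace_coords_conj)
  show "trace_class (q \<otimes>\<^bsub>cpoly_ring\<^esub> r) = trace_class q \<otimes>\<^bsub>invariant_ring\<^esub> trace_class r"
    using hom(1) by (simp add: trace_class_def invariant_ring_def)
  show "trace_class (q \<oplus>\<^bsub>cpoly_ring\<^esub> r) = trace_class q \<oplus>\<^bsub>invariant_ring\<^esub> trace_class r"
    using hom(2) by (simp add: trace_class_def invariant_ring_def)
  show "trace_class \<one>\<^bsub>cpoly_ring\<^esub> = \<one>\<^bsub>invariant_ring\<^esub>"
    using hom(3) by (simp add: trace_class_def invariant_ring_def)
qed

text \<open>Injectivity is the algebraic independence of the traces, surjectivity the description of
  invariant polynomials.\<close>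

lemma trace_class_iso: "trace_class \<in> ring_iso cpoly_ring invariant_ring"
proof -
  have "inj trace_class"
  proof (rule injI)
    fix q r
    assume "trace_class q = trace_class r"
    then show "q = r"
      by (intro tvar_cpoly_eqI) (auto simp: trace_class_def residue_class_eq_iff value_at_subst_trace_poly)
  qed
  moreover have "carrier invariant_ring \<subseteq> range trace_class"
  proof
    fix c assume "c \<in> carrier invariant_ring"
    then obtain p where c: "c = residue_class p" and inv: "\<forall>g\<in>SL2. \<forall>A\<in>SL2. \<forall>B\<in>SL2.
      value_at (entry_of (g ** A ** matrix_inv g, g ** B ** matrix_inv g)) p = value_at (entry_of (A, B)) p"
      unfolding carrier_invariant_ring by blast
    obtain q where "\<forall>x\<in>SL2 \<times> SL2. value_at (entry_of x) p = value_at (trace_coords x) q"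
      using invariant_polynomial_in_traces[of p] inv by blast
    then have "c = trace_class q"
      unfolding c trace_class_def residue_class_eq_iff by (simp add: value_at_subst_trace_poly)
    then show "c \<in> range trace_class" by simp
  qed
  moreover have "range trace_class \<subseteq> carrier invariant_ring"
    using ring_hom_closed[OF trace_class_hom] by auto
  ultimately show ?thesis
    unfolding ring_iso_def using trace_class_hom by (auto simp: bij_betw_def)
qed

theorem theorem5p11:
  shows "calg_isomorphic invariant_ring (\<lambda>c. residue_class (Const c))
           (cpoly_ring :: tvar cpoly ring) Const \<and>
         (\<forall>f :: cmat2 \<times> cmat2 \<Rightarrow> complex.
           regular_on_SL2_SL2 f \<and>
           (\<forall>g\<in>SL2. \<forall>x\<^sub>1\<in>SL2. \<forall>x\<^sub>2\<in>SL2.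
              f (x\<^sub>1, x\<^sub>2) = f (g ** x\<^sub>1 ** matrix_inv g, g ** x\<^sub>2 ** matrix_inv g)) \<longrightarrow>
           (\<exists>!q :: tvar cpoly. \<forall>x\<^sub>1\<in>SL2. \<forall>x\<^sub>2\<in>SL2.
              f (x\<^sub>1, x\<^sub>2) = eval_cpoly (\<lambda>c. c) (trace_coords (x\<^sub>1, x\<^sub>2)) q))"
proof (intro conjI allI impI)
  let ?\<phi> = "inv_into (carrier cpoly_ring) trace_class"
  have "?\<phi> \<in> ring_iso invariant_ring cpoly_ring"
    by (rule ring_iso_set_sym[OF ring_cpoly_ring trace_class_iso])
  moreover have "?\<phi> (residue_class (Const c)) = Const c" for c
  proof -
    have "inj trace_class"
      using trace_class_iso by (simp add: ring_iso_def bij_betw_def)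
    then have "?\<phi> (trace_class (Const c)) = Const c"
      by simp
    then show ?thesis by (simp add: trace_class_def)
  qed
  ultimately show "calg_isomorphic invariant_ring (\<lambda>c. residue_class (Const c))
      (cpoly_ring :: tvar cpoly ring) Const"
    unfolding calg_isomorphic_def by blast
next
  fix f :: "cmat2 \<times> cmat2 \<Rightarrow> complex"
  assume f: "regular_on_SL2_SL2 f \<and> (\<forall>g\<in>SL2. \<forall>x\<^sub>1\<in>SL2. \<forall>x\<^sub>2\<in>SL2.
    f (x\<^sub>1, x\<^sub>2) = f (g ** x\<^sub>1 ** matrix_inv g, g ** x\<^sub>2 ** matrix_inv g))"
  then obtain p where p: "\<forall>x\<in>SL2 \<times> SL2. f x = value_at (entry_of x) p"
    unfolding regular_on_SL2_SL2_def by blast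
  have "value_at (entry_of (g ** A ** matrix_inv g, g ** B ** matrix_inv g)) p = value_at (entry_of (A, B)) p"
    if "g \<in> SL2" "A \<in> SL2" "B \<in> SL2" for g A B
    using f p that SL2_conj by (metis mem_Sigma_iff)
  then obtain q where q: "\<forall>x\<in>SL2 \<times> SL2. value_at (entry_of x) p = value_at (trace_coords x) q"
    by (rule invariant_polynomial_in_traces)
  show "\<exists>!q :: tvar cpoly. \<forall>x\<^sub>1\<in>SL2. \<forall>x\<^sub>2\<in>SL2. f (x\<^sub>1, x\<^sub>2) = value_at (trace_coords (x\<^sub>1, x\<^sub>2)) q"
  proof (rule ex1I[of _ q])
    show "\<forall>x\<^sub>1\<in>SL2. \<forall>x\<^sub>2\<in>SL2. f (x\<^sub>1, x\<^sub>2) = value_at (trace_coords (x\<^sub>1, x\<^sub>2)) q"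
      using p q by simp
    fix r
    assume "\<forall>x\<^sub>1\<in>SL2. \<forall>x\<^sub>2\<in>SL2. f (x\<^sub>1, x\<^sub>2) = value_at (trace_coords (x\<^sub>1, x\<^sub>2)) r"
    then show "r = q"
      using p q by (intro tvar_cpoly_eqI) simp
  qed
qed

end
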